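(* The limits below exist and satisfy \[\lim_{d\to\infty}\frac{w_p(d)}{d}=\lim_{d\to\infty}\frac{w_c(d)}{d}\ge\frac{2+\sqrt2}{3},\qquad \lim_{d\to\infty}\frac{w_s(d)}{d}\ge\frac{102}{101}.\]
   Context: All notions are with respect to the lattice $\mathbb{Z}^d$. A convex body is hollow if its interior contains no lattice point. The lattice width of a convex body $K\subset\mathbb{R}^d$ is $\inf_{f\in(\mathbb{Z}^d)^*\setminus\{0\}}(\max_K f-\min_K f)$. $w_c(d)$ is the supremum of the lattice widths of hollow convex bodies in $\mathbb{R}^d$; $w_p(d)$ is the maximum lattice width of hollow lattice $d$-polytopes (polytopes with vertices in $\mathbb{Z}^d$); $w_s(d)$ is the maximum lattice width of hollow lattice $d$-simplices. *)

theory Defs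
  imports "HOL-Analysis.Analysis" "HOL-Analysis.Finite_Function_Topology"
begin

(* The dimension d has to vary inside a single statement, so R^d is not a type here: it is the
   subspace spanned by the first d coordinates of the normed space of finitely supported real
   sequences.  On it the norm of that space (an l1-norm) induces the Euclidean topology, and
   interiors are taken relative to it. *)

definition rspace :: "nat \<Rightarrow> (nat \<Rightarrow>\<^sub>0 real) set" where
  "rspace d = {x. Poly_Mapping.keys x \<subseteq> {..<d}}"

definition zlattice :: "nat \<Rightarrow> (nat \<Rightarrow>\<^sub>0 real) set" where
  "zlattice d = {x \<in> rspace d. \<forall>i. Poly_Mapping.lookup x i \<in> \<int>}"

(* A functional on R^d is represented by its extension that vanishes on the remaining coordinates,
   so that the zero functional is represented by the constant function 0 only. *)

definition dual_zlattice :: "nat \<Rightarrow> ((nat \<Rightarrow>\<^sub>0 real) \<Rightarrow> real) set" where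
  "dual_zlattice d = {f. linear f \<and> (\<forall>z \<in> zlattice d. f z \<in> \<int>) \<and>
     (\<forall>x. Poly_Mapping.keys x \<inter> {..<d} = {} \<longrightarrow> f x = 0)}"

definition lattice_width :: "nat \<Rightarrow> (nat \<Rightarrow>\<^sub>0 real) set \<Rightarrow> real" where
  "lattice_width d K = (INF f \<in> dual_zlattice d - {\<lambda>_. 0}. (SUP x\<in>K. f x) - (INF x\<in>K. f x))"

definition body_interior :: "nat \<Rightarrow> (nat \<Rightarrow>\<^sub>0 real) set \<Rightarrow> (nat \<Rightarrow>\<^sub>0 real) set" where
  "body_interior d K = top_of_set (rspace d) interior_of K"

definition convex_body :: "nat \<Rightarrow> (nat \<Rightarrow>\<^sub>0 real) set \<Rightarrow> bool" where
  "convex_body d K \<longleftrightarrow> K \<subseteq> rspace d \<and> compact K \<and> convex K \<and> body_interior d K \<noteq> {}"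

definition hollow :: "nat \<Rightarrow> (nat \<Rightarrow>\<^sub>0 real) set \<Rightarrow> bool" where
  "hollow d K \<longleftrightarrow> body_interior d K \<inter> zlattice d = {}"

(* Full-dimensionality is expressed by the nonempty interior in R^d. *)

definition lattice_polytope :: "nat \<Rightarrow> (nat \<Rightarrow>\<^sub>0 real) set \<Rightarrow> bool" where
  "lattice_polytope d P \<longleftrightarrow> polytope P \<and> P \<subseteq> rspace d \<and> body_interior d P \<noteq> {} \<and>
     {v. v extreme_point_of P} \<subseteq> zlattice d"

(* The second conjunct is the library predicate "simplex", which is restricted to
   Euclidean-space types and hence written out. *)

definition lattice_simplex :: "nat \<Rightarrow> (nat \<Rightarrow>\<^sub>0 real) set \<Rightarrow> bool" where
  "lattice_simplex d P \<longleftrightarrow> lattice_polytope d P \<and>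
     (\<exists>C. \<not> affine_dependent C \<and> card C = d + 1 \<and> P = convex hull C)"

(* Suprema are taken in the extended reals, so that they need no a priori finiteness.  They are
   finite by the flatness theorem; widths of lattice polytopes being integers, the suprema
   defining w_p and w_s are then maxima.  Limits of w(d)/d taken in ereal may be infinite: no linear
   upper bound on these quantities is known. *)

definition w_c :: "nat \<Rightarrow> ereal" where
  "w_c d = (SUP K \<in> {K. convex_body d K \<and> hollow d K}. ereal (lattice_width d K))"

definition w_p :: "nat \<Rightarrow> ereal" where
  "w_p d = (SUP P \<in> {P. lattice_polytope d P \<and> hollow d P}. ereal (lattice_width d P))"

definition w_s :: "nat \<Rightarrow> ereal" where
  "w_s d = (SUP P \<in> {P. lattice_simplex d P \<and> hollow d P}. ereal (lattice_width d P))"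

end

theory Submission
  imports Defs
begin

text \<open>If \<open>P\<close> and \<open>Q\<close> contain the origin and \<open>a P\<close>, \<open>b Q\<close> are hollow, then so is \<open>(a + b) (P \<oplus> Q)\<close>
  for the direct sum \<open>P \<oplus> Q = conv (P \<times> 0 \<union> 0 \<times> Q)\<close>, whose width is at least the smaller one of
  the widths of \<open>P\<close> and \<open>Q\<close>. Hence \<open>k P \<oplus> \<dots> \<oplus> k P\<close> with \<open>k\<close> summands is hollow of width \<open>k\<close> times that of \<open>P\<close>, it
  is a lattice polytope as soon as \<open>k\<close> clears the denominators of a rational \<open>P\<close>, and a simplex if
  \<open>P\<close> is one with a vertex at the origin. The remaining dimensions are reached by adding long segments.
  Every hollow convex body is approximated by rational polytopes having a lattice point of their
  boundary as origin, so \<open>liminf w\<^sub>p(d)/d\<close> is at least \<open>w\<^sub>c(n)/n\<close> for every \<open>n\<close>, and likewise for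
  \<open>w\<^sub>s\<close>. The numerical bounds come from a hollow tetrahedron of width \<open>2 + \<surd>2\<close> and from an empty
  4-simplex of width 4 and normalized volume 101, which stays hollow when dilated by 102/101 from a
  vertex.\<close>

section \<open>Coordinates, functionals and relative interiors\<close>

text \<open>What survives every construction is the quotient of width by dimension: a rational frame
  of dimension \<open>n\<close>, width \<open>w\<close> and dilation parameter \<open>t\<close>
  leads to a lower limit of at least \<open>t * w / n\<close>, because \<open>k\<close> summands
  multiply both the dimension and the admissible dilation by \<open>k\<close>. Clearing denominators
  is therefore free of charge, and rational bodies are as good as lattice polytopes. The obstacle is
  the origin. It must be a lattice point of the body, hence a boundary point of a hollow one, and a
  rational approximation need not contain any lattice point; one has to be added without losing
  hollowness. The limits exist as in Fekete's lemma, since each term is at most the lower limit. The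
  two constants are values of \<open>t * w / n\<close>, namely \<open>1 * (2 + sqrt 2) / 3\<close>
  and \<open>(102/101) * 4 / 4\<close>.\<close>

definition rvec :: "nat \<Rightarrow> (nat \<Rightarrow> real) \<Rightarrow> (nat \<Rightarrow>\<^sub>0 real)" where
  "rvec d g = Abs_poly_mapping (\<lambda>i. if i < d then g i else 0)"

lemma lookup_rvec [simp]: "Poly_Mapping.lookup (rvec d g) i = (if i < d then g i else 0)"
  unfolding rvec_def by (subst lookup_Abs_poly_mapping) (auto intro: finite_subset[of _ "{..<d}"])

lemma lookup_scaleR [simp]:
  "Poly_Mapping.lookup (r *\<^sub>R x) i = r * Poly_Mapping.lookup (x :: nat \<Rightarrow>\<^sub>0 real) i"
proof -
  have "finite {i. r * Poly_Mapping.lookup x i \<noteq> 0}"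
    by (rule finite_subset[of _ "Poly_Mapping.keys x"]) (auto simp: in_keys_iff)
  then show ?thesis
    by (simp add: scaleR_poly_mapping_def)
qed

lemma rspace_iff: "x \<in> rspace d \<longleftrightarrow> (\<forall>i\<ge>d. Poly_Mapping.lookup x i = 0)"
  unfolding rspace_def by (auto simp: in_keys_iff not_less subset_iff) (meson not_le)

lemma rvec_in_rspace [simp]: "rvec d g \<in> rspace d"
  by (simp add: rspace_iff)

lemma subspace_rspace: "subspace (rspace d)"
  by (auto simp: subspace_def rspace_iff lookup_add)

lemma rspace_zero [simp]: "0 \<in> rspace d"
  and rspace_add: "x \<in> rspace d \<Longrightarrow> y \<in> rspace d \<Longrightarrow> x + y \<in> rspace d"
  and rspace_diff: "x \<in> rspace d \<Longrightarrow> y \<in> rspace d \<Longrightarrow> x - y \<in> rspace d"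
  and rspace_scaleR: "x \<in> rspace d \<Longrightarrow> r *\<^sub>R x \<in> rspace d"
  by (simp_all add: rspace_iff lookup_add lookup_minus)

lemma convex_hull_subset_rspace: "C \<subseteq> rspace d \<Longrightarrow> convex hull C \<subseteq> rspace d"
  by (simp add: hull_minimal subspace_rspace subspace_imp_convex)

lemma norm_rspace:
  assumes "x \<in> rspace d"
  shows "norm x = (\<Sum>i<d. \<bar>Poly_Mapping.lookup x i\<bar>)"
proof -
  have "norm x = (\<Sum>i\<in>Poly_Mapping.keys x. \<bar>Poly_Mapping.lookup x i\<bar>)"
    by (simp add: norm_poly_mapping_def dist_poly_mapping_def)
  also have "\<dots> = (\<Sum>i<d. \<bar>Poly_Mapping.lookup x i\<bar>)"
    using assms by (intro sum.mono_neutral_left) (auto simp: rspace_def in_keys_iff)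
  finally show ?thesis .
qed

lemma zlattice_iff:
  "x \<in> zlattice d \<longleftrightarrow> x \<in> rspace d \<and> (\<forall>i<d. Poly_Mapping.lookup x i \<in> \<int>)"
  unfolding zlattice_def rspace_iff by (auto simp: not_less) (metis Ints_0 not_less)

lemma zlattice_zero [simp]: "0 \<in> zlattice d"
  and zlattice_add: "x \<in> zlattice d \<Longrightarrow> y \<in> zlattice d \<Longrightarrow> x + y \<in> zlattice d"
  and zlattice_diff: "x \<in> zlattice d \<Longrightarrow> y \<in> zlattice d \<Longrightarrow> x - y \<in> zlattice d"
  by (auto simp: zlattice_def lookup_add lookup_minus intro: rspace_add rspace_diff)

section \<open>Integral functionals as integer coefficient vectors\<close>

definition pairing :: "nat \<Rightarrow> (nat \<Rightarrow> int) \<Rightarrow> (nat \<Rightarrow>\<^sub>0 real) \<Rightarrow> real" where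
  "pairing d a x = (\<Sum>i<d. of_int (a i) * Poly_Mapping.lookup x i)"

lemma linear_pairing: "linear (pairing d a)"
  by (rule linearI)
     (simp_all add: pairing_def lookup_add algebra_simps sum.distrib sum_distrib_left)

lemma pairing_single: "pairing d a (Poly_Mapping.single i 1) = (if i < d then of_int (a i) else 0)"
proof -
  have "pairing d a (Poly_Mapping.single i 1) = (\<Sum>j<d. if j = i then of_int (a j) else 0)"
    unfolding pairing_def by (intro sum.cong) (auto simp: lookup_single when_def)
  then show ?thesis by simp
qed

lemma pairing_in_dual: "pairing d a \<in> dual_zlattice d"
proof -
  have "pairing d a z \<in> \<int>" if "z \<in> zlattice d" for z
    using that unfolding pairing_def by (auto simp: zlattice_def intro!: Ints_sum Ints_mult)
  moreover have "pairing d a x = 0" if "Poly_Mapping.keys x \<inter> {..<d} = {}" for x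
    using that unfolding pairing_def by (intro sum.neutral) (auto simp: in_keys_iff disjoint_iff)
  ultimately show ?thesis
    by (simp add: dual_zlattice_def linear_pairing)
qed

lemma pairing_eq_0_iff: "pairing d a = (\<lambda>_. 0) \<longleftrightarrow> (\<forall>i<d. a i = 0)"
proof
  assume "pairing d a = (\<lambda>_. 0)"
  then show "\<forall>i<d. a i = 0"
    using pairing_single[of d a] by (metis of_int_eq_0_iff)
qed (auto simp: pairing_def)

lemma rspace_expand:
  assumes "x \<in> rspace d"
  shows "x = (\<Sum>i<d. Poly_Mapping.lookup x i *\<^sub>R Poly_Mapping.single i 1)"
proof (rule poly_mapping_eqI)
  fix j
  have "Poly_Mapping.lookup (\<Sum>i<d. Poly_Mapping.lookup x i *\<^sub>R Poly_Mapping.single i 1) j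
      = (\<Sum>i<d. if i = j then Poly_Mapping.lookup x i else 0)"
    unfolding lookup_sum by (intro sum.cong) (auto simp: lookup_single when_def)
  also have "\<dots> = Poly_Mapping.lookup x j"
    using assms by (auto simp: rspace_iff)
  finally show "Poly_Mapping.lookup x j =
      Poly_Mapping.lookup (\<Sum>i<d. Poly_Mapping.lookup x i *\<^sub>R Poly_Mapping.single i 1) j" ..
qed

lemma dual_zlattice_eq: "dual_zlattice d = range (pairing d)"
proof (intro subset_antisym subsetI)
  fix f assume f: "f \<in> dual_zlattice d"
  then have lin: "linear f" by (simp add: dual_zlattice_def)
  define a where "a i = \<lfloor>f (Poly_Mapping.single i 1)\<rfloor>" for i
  have a: "of_int (a i) = f (Poly_Mapping.single i 1)" if "i < d" for i
  proof -
    have "Poly_Mapping.single i (1::real) \<in> zlattice d"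
      using that by (auto simp: zlattice_iff rspace_iff lookup_single when_def)
    then show ?thesis using f by (auto simp: dual_zlattice_def a_def floor_of_int elim!: Ints_cases)
  qed
  have "f x = pairing d a x" for x
  proof -
    \<comment> \<open>Truncating \<open>x\<close> to its first \<open>d\<close> coordinates changes
      it by a vector that \<open>f\<close> kills by definition of the dual.\<close>
    define y where "y = rvec d (Poly_Mapping.lookup x)"
    have "f (x - y) = 0"
      using f unfolding dual_zlattice_def
      by (auto simp: y_def in_keys_iff lookup_minus disjoint_iff)
    then have "f x = f y" using lin by (simp add: linear_diff)
    also have "\<dots> = f (\<Sum>i<d. Poly_Mapping.lookup y i *\<^sub>R Poly_Mapping.single i 1)"
      by (rule arg_cong[of _ _ f], rule rspace_expand) (simp add: y_def)
    also have "\<dots> = (\<Sum>i<d. Poly_Mapping.lookup y i * f (Poly_Mapping.single i 1))"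
      using lin by (simp add: linear_sum linear_cmul)
    also have "\<dots> = pairing d a x"
      unfolding pairing_def by (intro sum.cong) (auto simp: y_def a)
    finally show ?thesis .
  qed
  then show "f \<in> range (pairing d)" by blast
qed (auto simp: pairing_in_dual)

lemma abs_pairing_le:
  assumes "x \<in> rspace d"
  shows "\<bar>pairing d a x\<bar> \<le> (\<Sum>i<d. \<bar>real_of_int (a i)\<bar>) * norm x"
proof -
  have "\<bar>pairing d a x\<bar> \<le> (\<Sum>i<d. \<bar>real_of_int (a i)\<bar> * \<bar>Poly_Mapping.lookup x i\<bar>)"
    unfolding pairing_def by (rule order.trans[OF sum_abs]) (simp add: abs_mult)
  also have "\<dots> \<le> (\<Sum>i<d. \<bar>real_of_int (a i)\<bar> * norm x)"
    by (intro sum_mono mult_left_mono)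
       (auto simp: norm_rspace[OF assms] intro!: member_le_sum)
  finally show ?thesis by (simp add: sum_distrib_right)
qed

lemma bounded_pairing_image:
  assumes "bounded K" "K \<subseteq> rspace d"
  shows "bounded (pairing d a ` K)"
proof -
  obtain B where B: "\<And>x. x \<in> K \<Longrightarrow> norm x \<le> B"
    using assms(1) by (auto simp: bounded_iff)
  have "norm (pairing d a x) \<le> (\<Sum>i<d. \<bar>real_of_int (a i)\<bar>) * B" if "x \<in> K" for x
  proof -
    have "norm (pairing d a x) \<le> (\<Sum>i<d. \<bar>real_of_int (a i)\<bar>) * norm x"
      using abs_pairing_le that assms(2) by auto
    also have "\<dots> \<le> (\<Sum>i<d. \<bar>real_of_int (a i)\<bar>) * B"
      by (intro mult_left_mono B that sum_nonneg) auto
    finally show ?thesis .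
  qed
  then show ?thesis by (auto simp: bounded_iff)
qed

section \<open>Lattice width witnessed by pairs of points\<close>

lemma convex_hull_linear_le:
  fixes f :: "'a::real_vector \<Rightarrow> real"
  assumes "linear f" "x \<in> convex hull C"
  shows "\<exists>y\<in>C. f x \<le> f y"
proof (rule ccontr)
  assume "\<not> ?thesis"
  then have "C \<subseteq> f -` {..<f x}" by (auto simp: not_le)
  then have "convex hull C \<subseteq> f -` {..<f x}"
    by (rule hull_minimal) (rule convex_linear_vimage[OF assms(1)], simp)
  with assms(2) show False by auto
qed

text \<open>A lower bound on the width in which every functional has explicit witnesses in
  \<open>C\<close>. Free of suprema, it can be checked on vertices and carried through direct
  sums.\<close>

definition wide :: "nat \<Rightarrow> (nat \<Rightarrow>\<^sub>0 real) set \<Rightarrow> real \<Rightarrow> bool" where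
  "wide d C w \<longleftrightarrow> (\<forall>a. (\<exists>i<d. a i \<noteq> 0) \<longrightarrow> (\<exists>x\<in>C. \<exists>y\<in>C. w \<le> pairing d a x - pairing d a y))"

text \<open>Boundedness gives meaning to the supremum and infimum over \<open>K\<close>;
  \<open>d \<ge> 1\<close> keeps the infimum over functionals off the empty set.\<close>

lemma lattice_width_ge:
  assumes "wide d C w" "C \<subseteq> K" "bounded K" "K \<subseteq> rspace d" "d \<ge> 1"
  shows "w \<le> lattice_width d K"
  unfolding lattice_width_def
proof (rule cINF_greatest)
  have "pairing d (\<lambda>_. 1) \<in> dual_zlattice d - {\<lambda>_. 0}"
    using assms(5) by (auto simp: pairing_in_dual pairing_eq_0_iff intro!: exI[of _ 0])
  then show "dual_zlattice d - {\<lambda>_. 0} \<noteq> {}" by blast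
next
  fix f assume "f \<in> dual_zlattice d - {\<lambda>_. 0}"
  then obtain a where f: "f = pairing d a" and "\<exists>i<d. a i \<noteq> 0"
    by (auto simp: dual_zlattice_eq pairing_eq_0_iff)
  then obtain x y where xy: "x \<in> C" "y \<in> C" "w \<le> f x - f y"
    using assms(1) by (auto simp: wide_def)
  have "bounded (f ` K)" unfolding f by (rule bounded_pairing_image) fact+
  then have "f x \<le> (SUP x\<in>K. f x)" "(INF x\<in>K. f x) \<le> f y"
    using xy assms(2) by (auto intro!: cSUP_upper cINF_lower bounded_imp_bdd_above bounded_imp_bdd_below)
  with xy show "w \<le> (SUP x\<in>K. f x) - (INF x\<in>K. f x)" by linarith
qed

text \<open>The strict inequality makes up for extrema that need not be attained: if all differences
  were below \<open>w\<close>, their supremum would be at most \<open>w\<close>.\<close>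

lemma less_lattice_width_imp:
  assumes "w < lattice_width d K" "bounded K" "K \<subseteq> rspace d" "K \<noteq> {}"
  shows "wide d K w"
  unfolding wide_def
proof (intro allI impI)
  fix a :: "nat \<Rightarrow> int" assume a: "\<exists>i<d. a i \<noteq> 0"
  let ?f = "pairing d a"
  have bdd: "bdd_above (g ` K)" "bdd_below (g ` K)" if "g \<in> dual_zlattice d" for g
    using that bounded_pairing_image[OF assms(2,3)]
    by (auto simp: dual_zlattice_eq intro: bounded_imp_bdd_above bounded_imp_bdd_below)
  have "lattice_width d K \<le> (SUP x\<in>K. ?f x) - (INF x\<in>K. ?f x)"
    unfolding lattice_width_def
  proof (rule cINF_lower)
    show "?f \<in> dual_zlattice d - {\<lambda>_. 0}"
      using a by (auto simp: pairing_in_dual pairing_eq_0_iff)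
    obtain x where "x \<in> K" using assms(4) by blast
    have "0 \<le> (SUP x\<in>K. g x) - (INF x\<in>K. g x)" if "g \<in> dual_zlattice d" for g
      using cINF_lower[OF bdd(2)[OF that] \<open>x \<in> K\<close>] cSUP_upper[OF \<open>x \<in> K\<close> bdd(1)[OF that]]
      by linarith
    then show "bdd_below ((\<lambda>f. (SUP x\<in>K. f x) - (INF x\<in>K. f x)) ` (dual_zlattice d - {\<lambda>_. 0}))"
      by (intro bdd_belowI2[of _ 0]) auto
  qed
  with assms(1) have less: "w < (SUP x\<in>K. ?f x) - (INF x\<in>K. ?f x)" by simp
  show "\<exists>x\<in>K. \<exists>y\<in>K. w \<le> ?f x - ?f y"
  proof (rule ccontr)
    assume "\<not> ?thesis"
    then have *: "?f x - ?f y < w" if "x \<in> K" "y \<in> K" for x y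
      using that by force
    have "(SUP x\<in>K. ?f x) \<le> w + ?f y" if "y \<in> K" for y
      using *[OF _ that] by (intro cSUP_least assms(4)) (auto simp: field_simps intro: less_imp_le)
    then have "(SUP x\<in>K. ?f x) - w \<le> (INF x\<in>K. ?f x)"
      by (intro cINF_greatest assms(4)) (auto simp: field_simps)
    with less show False by linarith
  qed
qed

lemma wide_convex_hull:
  assumes "wide d (convex hull C) w"
  shows "wide d C w"
  unfolding wide_def
proof (intro allI impI)
  fix a :: "nat \<Rightarrow> int" assume "\<exists>i<d. a i \<noteq> 0"
  then obtain x y where xy: "x \<in> convex hull C" "y \<in> convex hull C" "w \<le> pairing d a x - pairing d a y"
    using assms by (auto simp: wide_def)
  obtain x' where "x' \<in> C" "pairing d a x \<le> pairing d a x'"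
    using convex_hull_linear_le[OF linear_pairing xy(1)] by blast
  moreover have "linear (\<lambda>x. - pairing d a x)"
    by (intro linear_compose_neg linear_pairing)
  then obtain y' where "y' \<in> C" "- pairing d a y \<le> - pairing d a y'"
    using convex_hull_linear_le[OF _ xy(2)] by blast
  ultimately show "\<exists>x\<in>C. \<exists>y\<in>C. w \<le> pairing d a x - pairing d a y"
    using xy(3) by (intro bexI[of _ x'] bexI[of _ y']) auto
qed

lemma wide_mono: "wide d C w \<Longrightarrow> C \<subseteq> C' \<Longrightarrow> w' \<le> w \<Longrightarrow> wide d C' w'"
  unfolding wide_def by (meson order_trans subsetD)

section \<open>Interiors relative to the coordinate subspace\<close>

lemma body_interior_iff:
  "x \<in> body_interior d K \<longleftrightarrow> x \<in> rspace d \<and> (\<exists>e>0. \<forall>y\<in>rspace d. dist x y < e \<longrightarrow> y \<in> K)"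
proof
  assume "x \<in> body_interior d K"
  then obtain U where "open U" "x \<in> U" "x \<in> rspace d" "U \<inter> rspace d \<subseteq> K"
    unfolding body_interior_def interior_of_def openin_open by auto
  then show "x \<in> rspace d \<and> (\<exists>e>0. \<forall>y\<in>rspace d. dist x y < e \<longrightarrow> y \<in> K)"
    by (metis IntI mem_ball openE subsetD)
next
  assume "x \<in> rspace d \<and> (\<exists>e>0. \<forall>y\<in>rspace d. dist x y < e \<longrightarrow> y \<in> K)"
  then obtain e where "x \<in> rspace d" "e > 0" "\<forall>y\<in>rspace d. dist x y < e \<longrightarrow> y \<in> K" by blast
  then show "x \<in> body_interior d K"
    unfolding body_interior_def interior_of_def mem_Collect_eq
    by (intro exI[of _ "rspace d \<inter> ball x e"]) (auto simp: openin_open)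
qed

lemma body_interior_mono: "K \<subseteq> L \<Longrightarrow> body_interior d K \<subseteq> body_interior d L"
  unfolding body_interior_def by (rule interior_of_mono)

lemma body_interior_subset: "body_interior d K \<subseteq> K"
  unfolding body_interior_def by (rule interior_of_subset)

lemma hollow_mono: "hollow d L \<Longrightarrow> K \<subseteq> L \<Longrightarrow> hollow d K"
  using body_interior_mono[of K L d] by (auto simp: hollow_def)

text \<open>Points within \<open>v * e\<close> of the combination are
  \<open>u *\<^sub>R y + v *\<^sub>R q\<close> with \<open>q\<close> within \<open>e\<close> of
  \<open>p\<close>. Only \<open>p\<close> has to be interior.\<close>

lemma body_interior_combination:
  assumes "convex P" "y \<in> P" "y \<in> rspace d" "p \<in> body_interior d P" "u \<ge> 0" "v > 0"
  shows "u *\<^sub>R y + v *\<^sub>R p \<in> body_interior d ((*\<^sub>R) (u + v) ` P)"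
proof -
  obtain e where e: "e > 0" "\<And>z. z \<in> rspace d \<Longrightarrow> dist p z < e \<Longrightarrow> z \<in> P" and p: "p \<in> rspace d"
    using assms(4) by (auto simp: body_interior_iff)
  have "z \<in> (*\<^sub>R) (u + v) ` P"
    if z: "z \<in> rspace d" "dist (u *\<^sub>R y + v *\<^sub>R p) z < v * e" for z
  proof -
    define q where "q = (1 / v) *\<^sub>R (z - u *\<^sub>R y)"
    have vq: "v *\<^sub>R q = z - u *\<^sub>R y" using assms(6) by (simp add: q_def)
    have "v * dist p q = norm (v *\<^sub>R p - v *\<^sub>R q)"
      using assms(6) by (simp add: dist_norm flip: scaleR_diff_right)
    also have "\<dots> < v * e" using z(2) by (simp add: vq dist_norm algebra_simps)
    finally have "dist p q < e" using assms(6) by simp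
    moreover have "q \<in> rspace d"
      unfolding q_def by (intro rspace_scaleR rspace_diff z assms)
    ultimately have "q \<in> P" by (intro e(2))
    have "(u / (u + v)) *\<^sub>R y + (v / (u + v)) *\<^sub>R q \<in> P"
      using assms(5,6)
      by (intro convexD assms(1,2) \<open>q \<in> P\<close>) (auto simp: add_divide_distrib[symmetric])
    moreover have "z = (u + v) *\<^sub>R ((u / (u + v)) *\<^sub>R y + (v / (u + v)) *\<^sub>R q)"
      using assms(5,6) by (simp add: scaleR_add_right vq)
    ultimately show ?thesis by blast
  qed
  then show ?thesis
    using assms e(1) p
    by (auto simp: body_interior_iff intro!: rspace_add rspace_scaleR exI[of _ "v * e"])
qed

lemma scaled_star_mono:
  assumes "convex P" "0 \<in> P" "0 \<le> s" "s \<le> t"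
  shows "(*\<^sub>R) s ` P \<subseteq> (*\<^sub>R) t ` P"
proof
  fix z assume "z \<in> (*\<^sub>R) s ` P"
  then obtain x where x: "x \<in> P" "z = s *\<^sub>R x" by blast
  show "z \<in> (*\<^sub>R) t ` P"
  proof (cases "t = 0")
    case False
    have "(s / t) *\<^sub>R x + (1 - s / t) *\<^sub>R 0 \<in> P"
      using assms False by (intro convexD) (auto simp: x)
    then show ?thesis using False by (intro image_eqI[of _ _ "(s / t) *\<^sub>R x"]) (auto simp: x)
  qed (use assms x in auto)
qed

lemma body_interior_extend:
  assumes "x \<in> body_interior d K" "b \<in> rspace d"
  obtains \<delta> where "\<delta> > 0" "x + \<delta> *\<^sub>R (x - b) \<in> K"
proof -
  obtain e where e: "e > 0" "\<And>z. z \<in> rspace d \<Longrightarrow> dist x z < e \<Longrightarrow> z \<in> K" and x: "x \<in> rspace d"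
    using assms(1) by (auto simp: body_interior_iff)
  \<comment> \<open>The summand 1 covers the case \<open>x = b\<close>.\<close>
  define \<delta> where "\<delta> = e / (1 + norm (x - b))"
  have n: "1 + norm (x - b) > 0" by (simp add: add_pos_nonneg)
  have pos: "\<delta> > 0" using e(1) n by (simp add: \<delta>_def)
  have "dist x (x + \<delta> *\<^sub>R (x - b)) = \<delta> * norm (x - b)" using pos by (simp add: dist_norm)
  also have "\<dots> < \<delta> * (1 + norm (x - b))" using pos by (simp add: algebra_simps)
  also have "\<dots> = e" using n by (simp add: \<delta>_def)
  finally have "x + \<delta> *\<^sub>R (x - b) \<in> K"
    using x assms(2) by (intro e(2) rspace_add rspace_scaleR rspace_diff) auto
  with pos that show ?thesis by blast
qed

text \<open>A nonconstant functional has no maximum at an interior point. This turns facet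
  inequalities into strict ones.\<close>

lemma body_interior_functional_less:
  assumes "x \<in> body_interior d K" "linear f" "\<And>y. y \<in> K \<Longrightarrow> f y \<le> c" "v \<in> rspace d" "f v \<noteq> (0::real)"
  shows "f x < c"
proof -
  \<comment> \<open>Moving away from this \<open>b\<close> means moving along \<open>v\<close> in
    the sense in which \<open>f\<close> increases.\<close>
  define b where "b = x - sgn (f v) *\<^sub>R v"
  have "b \<in> rspace d"
    using assms(1,4) by (auto simp: b_def body_interior_iff intro!: rspace_diff rspace_scaleR)
  then obtain \<delta> where \<delta>: "\<delta> > 0" "x + \<delta> *\<^sub>R (x - b) \<in> K"
    using body_interior_extend[OF assms(1)] by blast
  have "f (x + \<delta> *\<^sub>R (x - b)) = f x + \<delta> * (sgn (f v) * f v)"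
    using assms(2) by (simp add: b_def linear_add linear_cmul linear_diff)
  then have "f x + \<delta> * \<bar>f v\<bar> \<le> c"
    using assms(3)[OF \<delta>(2)] by (simp add: abs_sgn mult.commute)
  moreover have "\<delta> * \<bar>f v\<bar> > 0" using \<delta>(1) assms(5) by simp
  ultimately show ?thesis by linarith
qed

section \<open>Direct sums\<close>

text \<open>The parameter \<open>t\<close> records how far \<open>P = conv C\<close> can be dilated from the origin, which need
  not be interior to \<open>P\<close>, without an interior lattice point. Direct sums add these parameters and
  keep \<open>w\<close>.\<close>

definition hollow_frame :: "nat \<Rightarrow> (nat \<Rightarrow>\<^sub>0 real) set \<Rightarrow> real \<Rightarrow> real \<Rightarrow> bool" where
  "hollow_frame d C t w \<longleftrightarrow> finite C \<and> 0 \<in> C \<and> C \<subseteq> rspace d \<and>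
     body_interior d (convex hull C) \<noteq> {} \<and> hollow d ((*\<^sub>R) t ` (convex hull C)) \<and> wide d C w"

text \<open>For sets containing the origin this is affine independence of \<open>d + 1\<close>
  points, put linearly so that projections and spans apply.\<close>

definition simplex_frame :: "nat \<Rightarrow> (nat \<Rightarrow>\<^sub>0 real) set \<Rightarrow> bool" where
  "simplex_frame d C \<longleftrightarrow> card C = d + 1 \<and> independent (C - {0})"

section \<open>Two blocks of coordinates\<close>

definition shift :: "nat \<Rightarrow> nat \<Rightarrow> (nat \<Rightarrow>\<^sub>0 real) \<Rightarrow> (nat \<Rightarrow>\<^sub>0 real)" where
  "shift n m x = rvec (n + m) (\<lambda>i. if i < n then 0 else Poly_Mapping.lookup x (i - n))"

definition head :: "nat \<Rightarrow> (nat \<Rightarrow>\<^sub>0 real) \<Rightarrow> (nat \<Rightarrow>\<^sub>0 real)" where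
  "head n x = rvec n (Poly_Mapping.lookup x)"

definition tail :: "nat \<Rightarrow> nat \<Rightarrow> (nat \<Rightarrow>\<^sub>0 real) \<Rightarrow> (nat \<Rightarrow>\<^sub>0 real)" where
  "tail n m x = rvec m (\<lambda>i. Poly_Mapping.lookup x (n + i))"

text \<open>The first factor already lies in the first \<open>n\<close> coordinates of the common
  type, so only the second one is moved.\<close>

definition dsum :: "nat \<Rightarrow> nat \<Rightarrow> (nat \<Rightarrow>\<^sub>0 real) set \<Rightarrow> (nat \<Rightarrow>\<^sub>0 real) set \<Rightarrow> (nat \<Rightarrow>\<^sub>0 real) set" where
  "dsum n m A B = A \<union> shift n m ` B"

lemma shift_in_rspace [simp]: "shift n m x \<in> rspace (n + m)"
  and head_in_rspace [simp]: "head n x \<in> rspace n"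
  and tail_in_rspace [simp]: "tail n m x \<in> rspace m"
  by (simp_all add: shift_def head_def tail_def)

lemma linear_shift: "linear (shift n m)"
  and linear_head: "linear (head n)"
  and linear_tail: "linear (tail n m)"
  by (auto intro!: linearI poly_mapping_eqI simp: shift_def head_def tail_def lookup_add)

lemma shift_zero [simp]: "shift n m 0 = 0"
  by (simp add: linear_0 linear_shift)

lemma rspace_mono: "x \<in> rspace n \<Longrightarrow> x \<in> rspace (n + m)"
  by (auto simp: rspace_iff)

lemma head_add_shift: "x \<in> rspace n \<Longrightarrow> head n (x + shift n m y) = x"
  and tail_add_shift: "x \<in> rspace n \<Longrightarrow> y \<in> rspace m \<Longrightarrow> tail n m (x + shift n m y) = y"
  and head_shift_tail: "z \<in> rspace (n + m) \<Longrightarrow> head n z + shift n m (tail n m z) = z"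
  by (auto intro!: poly_mapping_eqI simp: shift_def head_def tail_def lookup_add rspace_iff)

lemma tail_shift: "y \<in> rspace m \<Longrightarrow> tail n m (shift n m y) = y"
  using tail_add_shift[of 0 n y m] by simp

lemma tail_eq_0: "x \<in> rspace n \<Longrightarrow> tail n m x = 0"
  using tail_add_shift[of x n 0 m] by simp

lemma zlattice_head: "z \<in> zlattice (n + m) \<Longrightarrow> head n z \<in> zlattice n"
  and zlattice_tail: "z \<in> zlattice (n + m) \<Longrightarrow> tail n m z \<in> zlattice m"
  and zlattice_shift: "y \<in> zlattice m \<Longrightarrow> shift n m y \<in> zlattice (n + m)"
  and zlattice_mono: "x \<in> zlattice n \<Longrightarrow> x \<in> zlattice (n + m)"
  by (auto simp: zlattice_def head_def tail_def shift_def rspace_iff)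

lemma sum_lessThan_add:
  fixes f :: "nat \<Rightarrow> 'a::comm_monoid_add"
  shows "sum f {..<n + m} = sum f {..<n} + (\<Sum>i<m. f (n + i))"
  by (induction m) (auto simp: add.assoc)

lemma norm_head_tail:
  assumes "z \<in> rspace (n + m)"
  shows "norm z = norm (head n z) + norm (tail n m z)"
  by (simp add: norm_rspace[OF assms] norm_rspace[OF head_in_rspace] norm_rspace[OF tail_in_rspace]
      sum_lessThan_add) (simp add: head_def tail_def)

text \<open>Convexity with unnormalized weights. If both weights vanish, any point of
  \<open>P\<close> serves.\<close>

lemma convex_scaled_add:
  assumes "convex P" "p \<ge> 0" "q \<ge> 0" "x \<in> P" "y \<in> P"
  obtains z where "z \<in> P" "p *\<^sub>R x + q *\<^sub>R y = (p + q) *\<^sub>R z"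
proof (cases "p + q = 0")
  case True
  with assms that[of x] show ?thesis by (simp add: add_nonneg_eq_0_iff)
next
  case False
  have "(p / (p + q)) *\<^sub>R x + (q / (p + q)) *\<^sub>R y \<in> P"
    using assms False by (intro convexD) (auto simp: add_divide_distrib[symmetric])
  with that show ?thesis using False by (force simp: scaleR_add_right)
qed

text \<open>The set \<open>Q\<close> of all these combinations is convex, as the parts in each block
  can be merged separately, and it contains the generators: each is paired with the origin of the
  other factor.\<close>

lemma convex_hull_dsum:
  assumes "z \<in> convex hull (dsum n m A B)" "0 \<in> A" "0 \<in> B"
  obtains u v x y where "u \<ge> 0" "v \<ge> 0" "u + v = 1" "x \<in> convex hull A" "y \<in> convex hull B"
    "z = u *\<^sub>R x + v *\<^sub>R shift n m y"
proof -
  define Q where "Q = {u *\<^sub>R x + v *\<^sub>R shift n m y | u v x y.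
     u \<ge> 0 \<and> v \<ge> 0 \<and> u + v = 1 \<and> x \<in> convex hull A \<and> y \<in> convex hull B}"
  have "convex Q"
  proof (rule convexI)
    fix z z' and \<alpha> \<beta> :: real
    assume "z \<in> Q" "z' \<in> Q" and ab: "0 \<le> \<alpha>" "0 \<le> \<beta>" "\<alpha> + \<beta> = 1"
    then obtain u v x y u' v' x' y' where
      1: "u \<ge> 0" "v \<ge> 0" "u + v = 1" "x \<in> convex hull A" "y \<in> convex hull B"
        "z = u *\<^sub>R x + v *\<^sub>R shift n m y" and
      2: "u' \<ge> 0" "v' \<ge> 0" "u' + v' = 1" "x' \<in> convex hull A" "y' \<in> convex hull B"
        "z' = u' *\<^sub>R x' + v' *\<^sub>R shift n m y'"
      unfolding Q_def by blast
    obtain x'' where x'': "x'' \<in> convex hull A"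
      "(\<alpha> * u) *\<^sub>R x + (\<beta> * u') *\<^sub>R x' = (\<alpha> * u + \<beta> * u') *\<^sub>R x''"
      using convex_scaled_add[OF convex_convex_hull, of "\<alpha> * u" "\<beta> * u'" x A x'] 1 2 ab by auto
    obtain y'' where y'': "y'' \<in> convex hull B"
      "(\<alpha> * v) *\<^sub>R y + (\<beta> * v') *\<^sub>R y' = (\<alpha> * v + \<beta> * v') *\<^sub>R y''"
      using convex_scaled_add[OF convex_convex_hull, of "\<alpha> * v" "\<beta> * v'" y B y'] 1 2 ab by auto
    have "\<alpha> *\<^sub>R z + \<beta> *\<^sub>R z' = ((\<alpha> * u) *\<^sub>R x + (\<beta> * u') *\<^sub>R x')
        + shift n m ((\<alpha> * v) *\<^sub>R y + (\<beta> * v') *\<^sub>R y')"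
      by (simp add: 1 2 linear_add[OF linear_shift] linear_cmul[OF linear_shift] algebra_simps)
    also have "\<dots> = (\<alpha> * u + \<beta> * u') *\<^sub>R x'' + (\<alpha> * v + \<beta> * v') *\<^sub>R shift n m y''"
      by (simp add: x'' y'' linear_cmul[OF linear_shift])
    finally have "\<alpha> *\<^sub>R z + \<beta> *\<^sub>R z' =
        (\<alpha> * u + \<beta> * u') *\<^sub>R x'' + (\<alpha> * v + \<beta> * v') *\<^sub>R shift n m y''" .
    moreover have "(\<alpha> * u + \<beta> * u') + (\<alpha> * v + \<beta> * v') = \<alpha> * (u + v) + \<beta> * (u' + v')"
      by (simp add: algebra_simps)
    then have "(\<alpha> * u + \<beta> * u') + (\<alpha> * v + \<beta> * v') = 1"
      using 1 2 ab by simp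
    ultimately show "\<alpha> *\<^sub>R z + \<beta> *\<^sub>R z' \<in> Q"
      unfolding Q_def mem_Collect_eq using x'' y'' 1 2 ab
      by (intro exI[of _ "\<alpha> * u + \<beta> * u'"] exI[of _ "\<alpha> * v + \<beta> * v'"] exI[of _ x''] exI[of _ y'']) auto
  qed
  moreover have "dsum n m A B \<subseteq> Q"
  proof
    fix z assume "z \<in> dsum n m A B"
    then consider "z \<in> A" | y where "y \<in> B" "z = shift n m y" by (auto simp: dsum_def)
    then show "z \<in> Q"
    proof cases
      case 1
      then show ?thesis unfolding Q_def mem_Collect_eq using assms(3)
        by (intro exI[of _ 1] exI[of _ 0] exI[of _ z] exI[of _ 0]) (auto intro: hull_inc)
    next
      case 2
      then show ?thesis unfolding Q_def mem_Collect_eq using assms(2)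
        by (intro exI[of _ 0] exI[of _ 1] exI[of _ 0] exI[of _ y]) (auto intro: hull_inc)
    qed
  qed
  ultimately have "convex hull (dsum n m A B) \<subseteq> Q" by (rule hull_minimal[rotated])
  with assms(1) that show ?thesis unfolding Q_def by blast
qed

lemma dsum_in_convex_hull:
  assumes "u \<ge> 0" "v \<ge> 0" "u + v = 1" "x \<in> convex hull A" "y \<in> convex hull B"
  shows "u *\<^sub>R x + v *\<^sub>R shift n m y \<in> convex hull (dsum n m A B)"
proof (rule convexD[OF convex_convex_hull])
  show "x \<in> convex hull (dsum n m A B)"
    using assms(4) hull_mono[of A "dsum n m A B" convex] by (auto simp: dsum_def)
  have "shift n m y \<in> convex hull (shift n m ` B)"
    using assms(5) convex_hull_linear_image[OF linear_shift] by blast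
  then show "shift n m y \<in> convex hull (dsum n m A B)"
    using hull_mono[of "shift n m ` B" "dsum n m A B" convex] by (auto simp: dsum_def)
qed (use assms in auto)

text \<open>Doubling the two components of a point near the midpoint gives points near
  \<open>p\<close> and \<open>q\<close>. The norm is additive over the blocks, so half the smaller
  radius suffices.\<close>

lemma body_interior_dsum:
  assumes "p \<in> body_interior n (convex hull A)" "q \<in> body_interior m (convex hull B)"
  shows "(1/2) *\<^sub>R p + (1/2) *\<^sub>R shift n m q \<in> body_interior (n + m) (convex hull (dsum n m A B))"
proof -
  obtain e where e: "e > 0" "\<And>z. z \<in> rspace n \<Longrightarrow> dist p z < e \<Longrightarrow> z \<in> convex hull A"
    and p: "p \<in> rspace n"
    using assms(1) by (auto simp: body_interior_iff)
  obtain e' where e': "e' > 0" "\<And>z. z \<in> rspace m \<Longrightarrow> dist q z < e' \<Longrightarrow> z \<in> convex hull B"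
    and q: "q \<in> rspace m"
    using assms(2) by (auto simp: body_interior_iff)
  let ?c = "(1/2) *\<^sub>R p + (1/2) *\<^sub>R shift n m q"
  have c: "?c \<in> rspace (n + m)"
    using p by (intro rspace_add rspace_scaleR) (auto intro: rspace_mono)
  have half: "?c = (1/2) *\<^sub>R p + shift n m ((1/2) *\<^sub>R q)"
    by (simp add: linear_cmul[OF linear_shift])
  have hc: "head n ?c = (1/2) *\<^sub>R p" "tail n m ?c = (1/2) *\<^sub>R q"
    unfolding half using p q by (simp_all add: head_add_shift tail_add_shift rspace_scaleR)
  have "z \<in> convex hull (dsum n m A B)"
    if z: "z \<in> rspace (n + m)" and d: "dist ?c z < min e e' / 2" for z
  proof -
    have "dist ?c z = norm (head n ?c - head n z) + norm (tail n m ?c - tail n m z)"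
      using norm_head_tail[of "?c - z" n m] c z
      by (simp add: dist_norm rspace_diff linear_diff[OF linear_head] linear_diff[OF linear_tail])
    also have "head n ?c - head n z = (1/2) *\<^sub>R (p - 2 *\<^sub>R head n z)"
      by (simp only: hc scaleR_diff_right) simp
    also have "tail n m ?c - tail n m z = (1/2) *\<^sub>R (q - 2 *\<^sub>R tail n m z)"
      by (simp only: hc scaleR_diff_right) simp
    finally have "dist ?c z = dist p (2 *\<^sub>R head n z) / 2 + dist q (2 *\<^sub>R tail n m z) / 2"
      by (simp add: dist_norm)
    with d have "dist p (2 *\<^sub>R head n z) < e" "dist q (2 *\<^sub>R tail n m z) < e'"
      using zero_le_dist[of p "2 *\<^sub>R head n z"] zero_le_dist[of q "2 *\<^sub>R tail n m z"]
      by linarith+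
    then have "2 *\<^sub>R head n z \<in> convex hull A" "2 *\<^sub>R tail n m z \<in> convex hull B"
      using e(2)[of "2 *\<^sub>R head n z"] e'(2)[of "2 *\<^sub>R tail n m z"] by (auto simp: rspace_scaleR)
    then have "(1/2) *\<^sub>R (2 *\<^sub>R head n z) + (1/2) *\<^sub>R shift n m (2 *\<^sub>R tail n m z)
        \<in> convex hull (dsum n m A B)"
      by (intro dsum_in_convex_hull) auto
    then show ?thesis
      using head_shift_tail[OF z] by (simp add: linear_cmul[OF linear_shift])
  qed
  moreover have "min e e' / 2 > 0" using e(1) e'(1) by simp
  ultimately show ?thesis using c unfolding body_interior_iff by blast
qed

text \<open>A lattice point \<open>x + y\<close> of the interior of \<open>(a + b) (P \<oplus> Q)\<close> has \<open>x \<in> int (\<sigma> P)\<close> and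
  \<open>y \<in> int (\<tau> Q)\<close> with \<open>\<sigma> + \<tau> < a + b\<close>, so that \<open>\<sigma> < a\<close> or \<open>\<tau> < b\<close>.\<close>

lemma hollow_dsum:
  assumes "hollow_frame n A a w" "hollow_frame m B b w'" "a > 0" "b > 0"
  shows "hollow (n + m) ((*\<^sub>R) (a + b) ` (convex hull (dsum n m A B)))"
proof -
  let ?P = "convex hull A" and ?Q = "convex hull B"
  have A: "A \<subseteq> rspace n" "0 \<in> A" "hollow n ((*\<^sub>R) a ` ?P)"
    and B: "B \<subseteq> rspace m" "0 \<in> B" "hollow m ((*\<^sub>R) b ` ?Q)"
    using assms by (auto simp: hollow_frame_def)
  obtain p q where p: "p \<in> body_interior n ?P" and q: "q \<in> body_interior m ?Q"
    using assms by (auto simp: hollow_frame_def)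
  have pr: "p \<in> rspace n" "q \<in> rspace m" using p q by (auto simp: body_interior_iff)
  have PR: "?P \<subseteq> rspace n" "?Q \<subseteq> rspace m"
    using A B by (auto dest: convex_hull_subset_rspace)
  have False
    if x: "x \<in> body_interior (n + m) ((*\<^sub>R) (a + b) ` (convex hull (dsum n m A B)))"
      "x \<in> zlattice (n + m)" for x
  proof -
    let ?s = "a + b"
    \<comment> \<open>This base point has total weight \<open>?s / 2\<close>, less than
      \<open>?s\<close>. Pushing \<open>x\<close> away from it leaves positive weights on
      \<open>p\<close> and \<open>q\<close>, which make both components interior, and total weight
      \<open>?s * (1 + \<delta> / 2) / (1 + \<delta>) < a + b\<close>.\<close>
    let ?b = "(?s / 4) *\<^sub>R p + (?s / 4) *\<^sub>R shift n m q"
    have "?b \<in> rspace (n + m)"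
      using pr by (intro rspace_add rspace_scaleR) (auto intro: rspace_mono)
    then obtain \<delta> where \<delta>: "\<delta> > 0" "x + \<delta> *\<^sub>R (x - ?b) \<in> (*\<^sub>R) ?s ` (convex hull (dsum n m A B))"
      using body_interior_extend[OF x(1)] by blast
    then obtain z where z: "z \<in> convex hull (dsum n m A B)" "x + \<delta> *\<^sub>R (x - ?b) = ?s *\<^sub>R z"
      by blast
    from convex_hull_dsum[OF z(1) A(2) B(2)]
    obtain u v y y' where uv: "u \<ge> 0" "v \<ge> 0" "u + v = 1" and y: "y \<in> ?P" "y' \<in> ?Q"
      and zeq: "z = u *\<^sub>R y + v *\<^sub>R shift n m y'" by blast
    define c where "c = ?s / (1 + \<delta>)"
    have c: "c > 0" using assms \<delta>(1) by (simp add: c_def)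
    have "(1 + \<delta>) *\<^sub>R x = ?s *\<^sub>R z + \<delta> *\<^sub>R ?b"
      using z(2) by (simp add: algebra_simps)
    then have "(1 / (1 + \<delta>)) *\<^sub>R ((1 + \<delta>) *\<^sub>R x) = (1 / (1 + \<delta>)) *\<^sub>R (?s *\<^sub>R z + \<delta> *\<^sub>R ?b)"
      by simp
    then have "x = (1 / (1 + \<delta>)) *\<^sub>R (?s *\<^sub>R z + \<delta> *\<^sub>R ?b)"
      using \<delta>(1) by simp
    also have "\<dots> = ((c * u) *\<^sub>R y + (c * (\<delta> / 4)) *\<^sub>R p)
        + shift n m ((c * v) *\<^sub>R y' + (c * (\<delta> / 4)) *\<^sub>R q)"
      using \<delta>(1)
      by (simp add: zeq c_def linear_add[OF linear_shift] linear_cmul[OF linear_shift]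
          scaleR_add_right add_ac mult_ac)
    finally have xeq: "x = ((c * u) *\<^sub>R y + (c * (\<delta> / 4)) *\<^sub>R p)
        + shift n m ((c * v) *\<^sub>R y' + (c * (\<delta> / 4)) *\<^sub>R q)" (is "x = ?x1 + shift n m ?x2") .
    have r: "?x1 \<in> rspace n" "?x2 \<in> rspace m"
      using pr y PR by (auto intro!: rspace_add rspace_scaleR)
    have lat: "?x1 \<in> zlattice n" "?x2 \<in> zlattice m"
      using zlattice_head[OF x(2)] zlattice_tail[OF x(2)] r
      by (simp_all add: xeq head_add_shift tail_add_shift)
    have i1: "?x1 \<in> body_interior n ((*\<^sub>R) (c * u + c * (\<delta> / 4)) ` ?P)"
      using y PR p uv c \<delta>(1) by (intro body_interior_combination) auto
    have i2: "?x2 \<in> body_interior m ((*\<^sub>R) (c * v + c * (\<delta> / 4)) ` ?Q)"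
      using y PR q uv c \<delta>(1) by (intro body_interior_combination) auto
    have "\<not> c * u + c * (\<delta> / 4) \<le> a"
    proof
      assume *: "c * u + c * (\<delta> / 4) \<le> a"
      have "(*\<^sub>R) (c * u + c * (\<delta> / 4)) ` ?P \<subseteq> (*\<^sub>R) a ` ?P"
        using * A uv c \<delta>(1) by (intro scaled_star_mono) (auto intro: hull_inc)
      from body_interior_mono[OF this] i1 lat(1) A(3) show False by (auto simp: hollow_def)
    qed
    moreover have "\<not> c * v + c * (\<delta> / 4) \<le> b"
    proof
      assume *: "c * v + c * (\<delta> / 4) \<le> b"
      have "(*\<^sub>R) (c * v + c * (\<delta> / 4)) ` ?Q \<subseteq> (*\<^sub>R) b ` ?Q"
        using * B uv c \<delta>(1) by (intro scaled_star_mono) (auto intro: hull_inc)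
      from body_interior_mono[OF this] i2 lat(2) B(3) show False by (auto simp: hollow_def)
    qed
    ultimately have gt: "a + b < c * (u + v) + c * (\<delta> / 2)" by (simp add: algebra_simps)
    have "c * (u + v) + c * (\<delta> / 2) = c * (1 + \<delta> / 2)"
      unfolding uv(3) by (simp add: algebra_simps)
    also have "\<dots> = (a + b) * (1 + \<delta> / 2) / (1 + \<delta>)"
      by (simp add: c_def)
    also have "\<dots> < a + b"
      using \<delta>(1) assms by (simp add: divide_less_eq)
    finally show False using gt by simp
  qed
  then show ?thesis by (auto simp: hollow_def)
qed

lemma pairing_rspace_add:
  assumes "x \<in> rspace n" shows "pairing (n + m) a x = pairing n a x"
  using assms by (simp add: pairing_def sum_lessThan_add rspace_iff)

lemma pairing_shift: "pairing (n + m) a (shift n m x) = pairing m (\<lambda>i. a (n + i)) x"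
  by (simp add: pairing_def sum_lessThan_add) (simp add: shift_def)

text \<open>A nonzero functional has a nonzero restriction to one of the blocks, and that factor
  provides the witnesses.\<close>

lemma wide_dsum:
  assumes "wide n A w" "wide m B w" "A \<subseteq> rspace n"
  shows "wide (n + m) (dsum n m A B) w"
  unfolding wide_def
proof (intro allI impI)
  fix a :: "nat \<Rightarrow> int" assume "\<exists>i<n + m. a i \<noteq> 0"
  then obtain i where i: "i < n + m" "a i \<noteq> 0" by blast
  show "\<exists>x\<in>dsum n m A B. \<exists>y\<in>dsum n m A B. w \<le> pairing (n + m) a x - pairing (n + m) a y"
  proof (cases "i < n")
    case True
    then obtain x y where "x \<in> A" "y \<in> A" "w \<le> pairing n a x - pairing n a y"
      using assms(1) i unfolding wide_def by blast
    then show ?thesis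
      using assms(3) by (intro bexI[of _ x] bexI[of _ y]) (auto simp: pairing_rspace_add subset_iff dsum_def)
  next
    case False
    then have "i - n < m" "a (n + (i - n)) \<noteq> 0" using i by auto
    then obtain x y where "x \<in> B" "y \<in> B"
      "w \<le> pairing m (\<lambda>i. a (n + i)) x - pairing m (\<lambda>i. a (n + i)) y"
      using assms(2) unfolding wide_def by (metis (no_types, lifting))
    then show ?thesis
      by (intro bexI[of _ "shift n m x"] bexI[of _ "shift n m y"]) (auto simp: pairing_shift dsum_def)
  qed
qed

lemma hollow_frame_dsum:
  assumes "hollow_frame n A a w" "hollow_frame m B b w" "a > 0" "b > 0"
  shows "hollow_frame (n + m) (dsum n m A B) (a + b) w"
proof -
  have "body_interior (n + m) (convex hull (dsum n m A B)) \<noteq> {}"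
    using assms body_interior_dsum by (fastforce simp: hollow_frame_def)
  moreover have "dsum n m A B \<subseteq> rspace (n + m)"
    using assms by (auto simp: hollow_frame_def dsum_def intro: rspace_mono)
  ultimately show ?thesis
    using assms hollow_dsum[OF assms] wide_dsum[of n A w m B]
    by (auto simp: hollow_frame_def dsum_def)
qed

text \<open>The projection \<open>tail\<close> sends \<open>A\<close> to 0 and undoes the shift on
  \<open>B\<close>, so a dependency involving a shifted vector would descend to
  \<open>B\<close>.\<close>

lemma independent_dsum:
  assumes "finite B" "independent B" "independent A" "A \<subseteq> rspace n" "B \<subseteq> rspace m"
  shows "independent (A \<union> shift n m ` B)"
  using assms
proof (induction B rule: finite_induct)
  case (insert b B)
  then have b: "b \<notin> span B" "independent B"
    by (auto simp: independent_insert)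
  have "shift n m b \<notin> span (A \<union> shift n m ` B)"
  proof
    assume "shift n m b \<in> span (A \<union> shift n m ` B)"
    then have "tail n m (shift n m b) \<in> span (tail n m ` (A \<union> shift n m ` B))"
      using linear_span_image[OF linear_tail] by blast
    moreover have "tail n m ` (A \<union> shift n m ` B) \<subseteq> insert 0 B"
      using insert.prems by (auto simp: tail_eq_0 tail_shift)
    then have "span (tail n m ` (A \<union> shift n m ` B)) \<subseteq> span B"
      by (metis span_insert_0 span_mono)
    ultimately show False using b(1) insert.prems by (auto simp: tail_shift)
  qed
  then have "independent (insert (shift n m b) (A \<union> shift n m ` B))"
    using insert b by (intro independent_insertI) auto
  then show ?case by simp
qed simp

lemma inj_on_shift: "inj_on (shift n m) (rspace m)"
  by (rule inj_on_inverseI[of _ "tail n m"]) (rule tail_shift)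

text \<open>The two vertex sets share exactly the origin, which leaves
  \<open>(n + 1) + (m + 1) - 1\<close> vertices.\<close>

lemma simplex_frame_dsum:
  assumes "simplex_frame n A" "simplex_frame m B" "A \<subseteq> rspace n" "B \<subseteq> rspace m" "0 \<in> A" "0 \<in> B"
  shows "simplex_frame (n + m) (dsum n m A B)"
proof -
  have fin: "finite A" "finite B"
    using assms by (auto simp: simplex_frame_def intro: card_ge_0_finite)
  have eq: "shift n m ` B - {0} = shift n m ` (B - {0})"
    using assms(4) inj_on_shift[of n m] by (auto simp: inj_on_def)
  have "x = 0" if "x \<in> A" "x = shift n m y" "y \<in> B" for x y
  proof -
    have "tail n m x = y" using that assms by (auto simp: tail_shift)
    moreover have "tail n m x = 0" using that assms by (auto intro: tail_eq_0)
    ultimately show ?thesis using that by simp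
  qed
  then have disj: "A \<inter> shift n m ` (B - {0}) = {}"
    using eq by fastforce
  have "dsum n m A B = A \<union> shift n m ` (B - {0})"
    using assms(5) eq unfolding dsum_def by auto
  moreover have "card (shift n m ` (B - {0})) = card (B - {0})"
    using assms(4) by (intro card_image inj_on_subset[OF inj_on_shift]) auto
  ultimately have "card (dsum n m A B) = n + m + 1"
    using assms fin disj by (simp add: card_Un_disjoint simplex_frame_def)
  moreover have "dsum n m A B - {0} = (A - {0}) \<union> shift n m ` (B - {0})"
    using eq by (auto simp: dsum_def)
  ultimately show ?thesis
    using assms fin independent_dsum[of "B - {0}" "A - {0}" n m]
    by (auto simp: simplex_frame_def)
qed

section \<open>Dilations, iterated sums and pyramids\<close>

lemma hollow_frame_mono:
  assumes "hollow_frame d C t w" "0 \<le> s" "s \<le> t" "w' \<le> w"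
  shows "hollow_frame d C s w'"
proof -
  have "(*\<^sub>R) s ` (convex hull C) \<subseteq> (*\<^sub>R) t ` (convex hull C)"
    using assms by (intro scaled_star_mono) (auto simp: hollow_frame_def intro: hull_inc)
  then show ?thesis
    using assms by (auto simp: hollow_frame_def intro: hollow_mono wide_mono)
qed

text \<open>Carries out the dilation that the parameter allows: the parameter becomes 1 and the
  width gains the factor \<open>q\<close>.\<close>

lemma hollow_frame_scale:
  assumes "hollow_frame d C q w" "q > 0"
  shows "hollow_frame d ((*\<^sub>R) q ` C) 1 (q * w)"
proof -
  have hull: "convex hull ((*\<^sub>R) q ` C) = (*\<^sub>R) q ` (convex hull C)"
    by (rule convex_hull_scaling)
  obtain p where p: "p \<in> body_interior d (convex hull C)"
    using assms by (auto simp: hollow_frame_def)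
  have "0 *\<^sub>R 0 + q *\<^sub>R p \<in> body_interior d ((*\<^sub>R) (0 + q) ` (convex hull C))"
    using assms p
    by (intro body_interior_combination) (auto simp: hollow_frame_def intro: hull_inc)
  then have "body_interior d (convex hull ((*\<^sub>R) q ` C)) \<noteq> {}"
    by (auto simp: hull)
  moreover have "wide d ((*\<^sub>R) q ` C) (q * w)"
    unfolding wide_def
  proof (intro allI impI)
    fix a :: "nat \<Rightarrow> int" assume "\<exists>i<d. a i \<noteq> 0"
    moreover have "wide d C w" using assms(1) by (simp add: hollow_frame_def)
    ultimately obtain x y where "x \<in> C" "y \<in> C" "w \<le> pairing d a x - pairing d a y"
      unfolding wide_def by blast
    then show "\<exists>x\<in>(*\<^sub>R) q ` C. \<exists>y\<in>(*\<^sub>R) q ` C. q * w \<le> pairing d a x - pairing d a y"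
      using assms(2) by (intro bexI[of _ "q *\<^sub>R x"] bexI[of _ "q *\<^sub>R y"])
        (auto simp: linear_cmul[OF linear_pairing] simp flip: right_diff_distrib)
  qed
  ultimately show ?thesis
    using assms by (auto simp: hollow_frame_def hull rspace_scaleR image_iff intro: bexI[of _ 0])
qed

lemma simplex_frame_scale:
  assumes "simplex_frame d C" "q \<noteq> 0"
  shows "simplex_frame d ((*\<^sub>R) q ` C)"
proof -
  have inj: "inj ((*\<^sub>R) q :: (nat \<Rightarrow>\<^sub>0 real) \<Rightarrow> _)" using assms(2) by (auto intro: injI)
  then have "independent ((*\<^sub>R) q ` (C - {0}))"
    using assms(1) by (intro linear_independent_injective_image) (auto simp: simplex_frame_def inj_on_def)
  moreover have "(*\<^sub>R) q ` C - {0} = (*\<^sub>R) q ` (C - {0})" using assms(2) by auto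
  moreover have "card ((*\<^sub>R) q ` C) = card C" using inj by (simp add: card_image inj_on_subset)
  ultimately show ?thesis using assms by (simp add: simplex_frame_def)
qed

text \<open>The common denominator \<open>q\<close> stays fixed while the parameter grows linearly
  in \<open>k\<close>, so that it finally exceeds \<open>q\<close>.\<close>

lemma hollow_frame_power:
  assumes "hollow_frame n A t w" "t > 0" "\<forall>x\<in>A. q *\<^sub>R x \<in> zlattice n" "k \<ge> 1"
  obtains D where "hollow_frame (k * n) D (real k * t) w" "\<forall>x\<in>D. q *\<^sub>R x \<in> zlattice (k * n)"
    "simplex_frame n A \<Longrightarrow> simplex_frame (k * n) D"
proof -
  have "\<exists>D. hollow_frame (k * n) D (real k * t) w \<and> (\<forall>x\<in>D. q *\<^sub>R x \<in> zlattice (k * n)) \<and>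
    (simplex_frame n A \<longrightarrow> simplex_frame (k * n) D)"
    using assms(4)
  proof (induction k rule: nat_induct_at_least)
    case base
    show ?case using assms by (intro exI[of _ A]) auto
  next
    case (Suc k)
    then obtain D where D: "hollow_frame (k * n) D (real k * t) w"
      "\<forall>x\<in>D. q *\<^sub>R x \<in> zlattice (k * n)" "simplex_frame n A \<longrightarrow> simplex_frame (k * n) D" by blast
    let ?E = "dsum n (k * n) A D"
    have "hollow_frame (n + k * n) ?E (t + real k * t) w"
      using assms D Suc.hyps by (intro hollow_frame_dsum) auto
    moreover have "q *\<^sub>R x \<in> zlattice (n + k * n)" if "x \<in> ?E" for x
      using that assms(3) D(2) zlattice_mono zlattice_shift
      by (auto simp: dsum_def simp flip: linear_cmul[OF linear_shift])
    moreover have "simplex_frame (n + k * n) ?E" if "simplex_frame n A"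
      using that D assms by (intro simplex_frame_dsum) (auto simp: hollow_frame_def)
    moreover have "real (Suc k) * t = t + real k * t" by (simp add: algebra_simps)
    ultimately show ?case by (intro exI[of _ ?E]) auto
  qed
  with that show ?thesis by blast
qed

definition axis_segment :: "real \<Rightarrow> (nat \<Rightarrow>\<^sub>0 real) set" where
  "axis_segment L = {0, L *\<^sub>R Poly_Mapping.single 0 1}"

lemma rspace_1: "x \<in> rspace 1 \<Longrightarrow> x = Poly_Mapping.lookup x 0 *\<^sub>R Poly_Mapping.single 0 1"
  using rspace_expand[of x 1] by simp

text \<open>The parameter is \<open>1 / L\<close> because this dilate is the unit segment, and no
  integer lies strictly between 0 and 1.\<close>

lemma hollow_frame_axis_segment:
  assumes "L > 0"
  shows "hollow_frame 1 (axis_segment L) (1 / L) L"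
proof -
  let ?e = "Poly_Mapping.single 0 1 :: nat \<Rightarrow>\<^sub>0 real"
  have e: "?e \<in> rspace 1" by (auto simp: rspace_iff lookup_one when_def)
  have hull: "convex hull (axis_segment L) = {(v * L) *\<^sub>R ?e | v. 0 \<le> v \<and> v \<le> 1}"
    by (auto simp: axis_segment_def convex_hull_2) (metis add.commute diff_ge_0_iff_ge le_add_diff_inverse)
  have "(L / 2) *\<^sub>R ?e \<in> body_interior 1 (convex hull (axis_segment L))"
    unfolding body_interior_iff
  proof (intro conjI exI[of _ "L / 2"] ballI impI)
    fix y assume y: "y \<in> rspace 1" "dist ((L / 2) *\<^sub>R ?e) y < L / 2"
    have "dist ((L / 2) *\<^sub>R ?e) y = \<bar>L / 2 - Poly_Mapping.lookup y 0\<bar>"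
      using norm_rspace[of "(L / 2) *\<^sub>R ?e - y" 1] y(1) e
      by (simp add: dist_norm rspace_diff rspace_scaleR lookup_minus)
    with y(2) have "0 \<le> Poly_Mapping.lookup y 0 / L" "Poly_Mapping.lookup y 0 / L \<le> 1"
      using assms by (simp_all add: field_simps abs_less_iff)
    moreover have "y = (Poly_Mapping.lookup y 0 / L * L) *\<^sub>R ?e"
      using rspace_1[OF y(1)] assms by simp
    ultimately show "y \<in> convex hull (axis_segment L)" unfolding hull by blast
  qed (use assms e in \<open>auto intro: rspace_scaleR\<close>)
  moreover have "hollow 1 ((*\<^sub>R) (1 / L) ` (convex hull (axis_segment L)))"
  proof -
    let ?K = "(*\<^sub>R) (1 / L) ` (convex hull (axis_segment L))"
    have False if x: "x \<in> body_interior 1 ?K" "x \<in> zlattice 1" for x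
    proof -
      let ?f = "pairing 1 (\<lambda>_. 1)"
      have K: "0 \<le> ?f z" "?f z \<le> 1" if "z \<in> ?K" for z
        using that assms by (auto simp: hull pairing_def lookup_one)
      have "?f x < 1"
        using K by (intro body_interior_functional_less[OF x(1) linear_pairing _ e]) (auto simp: pairing_def lookup_one)
      moreover have "- ?f x < 0"
        using K by (intro body_interior_functional_less[OF x(1) _ _ e, of "\<lambda>x. - ?f x"]
            linear_compose_neg linear_pairing) (auto simp: pairing_def lookup_one)
      moreover obtain k where "?f x = of_int k"
        using x(2) by (auto simp: zlattice_iff pairing_def elim: Ints_cases)
      ultimately show False by simp
    qed
    then show ?thesis by (auto simp: hollow_def)
  qed
  moreover have "wide 1 (axis_segment L) L"
    unfolding wide_def
  proof (intro allI impI)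
    fix a :: "nat \<Rightarrow> int" assume "\<exists>i<1. a i \<noteq> 0"
    then consider "a 0 \<ge> 1" | "a 0 \<le> -1" by force
    then show "\<exists>x\<in>axis_segment L. \<exists>y\<in>axis_segment L. L \<le> pairing 1 a x - pairing 1 a y"
    proof cases
      case 1
      then show ?thesis using assms
        by (intro bexI[of _ "L *\<^sub>R ?e"] bexI[of _ 0]) (auto simp: axis_segment_def pairing_def)
    next
      case 2
      then have "1 \<le> - real_of_int (a 0)" by linarith
      then have "L \<le> - (real_of_int (a 0) * L)"
        using mult_right_mono[of 1 "- real_of_int (a 0)" L] assms by simp
      then show ?thesis
        by (intro bexI[of _ "L *\<^sub>R ?e"] bexI[of _ 0]) (auto simp: axis_segment_def pairing_def)
    qed
  qed
  ultimately show ?thesis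
    using e by (auto simp: hollow_frame_def) (auto simp: axis_segment_def rspace_scaleR)
qed

lemma simplex_frame_axis_segment:
  assumes "L \<noteq> 0"
  shows "simplex_frame 1 (axis_segment L)"
proof -
  have nz: "L *\<^sub>R Poly_Mapping.single 0 1 \<noteq> (0 :: nat \<Rightarrow>\<^sub>0 real)"
    using assms by (simp add: poly_mapping_eq_iff fun_eq_iff lookup_single when_def exI[of _ 0])
  then have "axis_segment L - {0} = {L *\<^sub>R Poly_Mapping.single 0 1}"
    by (auto simp: axis_segment_def)
  with nz show ?thesis by (auto simp: simplex_frame_def axis_segment_def)
qed

text \<open>The direct sum with a segment starting at the origin is a pyramid. A segment of length
  at least \<open>w\<close> costs no width, and the parameter gained is given away again.\<close>

lemma hollow_frame_pyramid:
  assumes "hollow_frame d C 1 w" "C \<subseteq> zlattice d" "d \<le> d'"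
  obtains D where "hollow_frame d' D 1 w" "D \<subseteq> zlattice d'" "simplex_frame d C \<Longrightarrow> simplex_frame d' D"
proof -
  have "\<exists>D. hollow_frame d' D 1 w \<and> D \<subseteq> zlattice d' \<and> (simplex_frame d C \<longrightarrow> simplex_frame d' D)"
    using assms(3)
  proof (induction d' rule: dec_induct)
    case base
    then show ?case using assms by blast
  next
    case (step d')
    then obtain D where D: "hollow_frame d' D 1 w" "D \<subseteq> zlattice d'"
      "simplex_frame d C \<longrightarrow> simplex_frame d' D" by blast
    \<comment> \<open>An integer keeps the apex in the lattice; the maximum with 1 keeps it away
      from the origin even if \<open>w\<close> is not positive.\<close>
    define L where "L = max 1 (real_of_int \<lceil>w\<rceil>)"
    have L: "L > 0" "w \<le> L" "L \<in> \<int>" by (auto simp: L_def max_def)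
    let ?I = "axis_segment L"
    have I: "hollow_frame 1 ?I (1 / L) L" using L by (intro hollow_frame_axis_segment)
    then have "hollow_frame 1 ?I (1 / L) w" using L by (intro hollow_frame_mono[OF I]) auto
    then have "hollow_frame (d' + 1) (dsum d' 1 D ?I) (1 + 1 / L) w"
      using D L by (intro hollow_frame_dsum) auto
    then have "hollow_frame (d' + 1) (dsum d' 1 D ?I) 1 w"
      by (rule hollow_frame_mono) (use L in auto)
    moreover have "?I \<subseteq> zlattice 1"
      using L by (auto simp: axis_segment_def zlattice_iff rspace_iff lookup_one when_def)
    then have "dsum d' 1 D ?I \<subseteq> zlattice (d' + 1)"
      using D zlattice_mono zlattice_shift unfolding dsum_def by blast
    moreover have "simplex_frame (d' + 1) (dsum d' 1 D ?I)" if "simplex_frame d C"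
      using that D L I simplex_frame_axis_segment[of L]
      by (intro simplex_frame_dsum) (auto simp: hollow_frame_def)
    ultimately show ?case by (intro exI[of _ "dsum d' 1 D ?I"]) auto
  qed
  with that show ?thesis by blast
qed

lemma bounded_convex_hull_finite:
  fixes C :: "'a::real_normed_vector set"
  shows "finite C \<Longrightarrow> bounded (convex hull C)"
  by (simp add: compact_imp_bounded finite_imp_compact_convex_hull)

lemma hollow_frame_imp_polytope:
  assumes "hollow_frame d C 1 w" "C \<subseteq> zlattice d" "d \<ge> 1"
  shows "lattice_polytope d (convex hull C)" "hollow d (convex hull C)"
    "w \<le> lattice_width d (convex hull C)"
    "simplex_frame d C \<Longrightarrow> lattice_simplex d (convex hull C)"
proof -
  have C: "finite C" "0 \<in> C" "C \<subseteq> rspace d" "body_interior d (convex hull C) \<noteq> {}"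
    "hollow d (convex hull C)" "wide d C w"
    using assms by (auto simp: hollow_frame_def)
  show lp: "lattice_polytope d (convex hull C)"
    using C assms(2) extreme_points_of_convex_hull[of C]
    by (auto simp: lattice_polytope_def polytope_def dest: convex_hull_subset_rspace)
  show "hollow d (convex hull C)" by fact
  show "w \<le> lattice_width d (convex hull C)"
    using C assms(3)
    by (intro lattice_width_ge[of d C] bounded_convex_hull_finite convex_hull_subset_rspace)
       (auto intro: hull_inc)
  assume "simplex_frame d C"
  then show "lattice_simplex d (convex hull C)"
    using lp affine_dependent_iff_dependent2[OF C(2)]
    by (auto simp: lattice_simplex_def simplex_frame_def)
qed

text \<open>With \<open>q \<le> k t\<close>, the dilation by \<open>q\<close> of the direct sum of \<open>k\<close> copies of the given frame is
  a hollow lattice polytope of width \<open>q w\<close>; pyramids reach all the larger dimensions.\<close>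

lemma hollow_frame_lower_bound:
  fixes k q :: nat
  assumes "hollow_frame n A t w" "n \<ge> 1" "t > 0"
    and lat: "\<forall>x\<in>A. real q *\<^sub>R x \<in> zlattice n"
    and "q \<ge> 1" "k \<ge> 1" "real q \<le> real k * t" "d \<ge> k * n"
  shows "ereal (real q * w) \<le> w_p d" "simplex_frame n A \<Longrightarrow> ereal (real q * w) \<le> w_s d"
proof -
  obtain D where D: "hollow_frame (k * n) D (real k * t) w" "\<forall>x\<in>D. real q *\<^sub>R x \<in> zlattice (k * n)"
    "simplex_frame n A \<Longrightarrow> simplex_frame (k * n) D"
    using hollow_frame_power[OF assms(1,3) lat assms(6)] by blast
  let ?E = "(*\<^sub>R) (real q) ` D"
  have "hollow_frame (k * n) D (real q) w" by (rule hollow_frame_mono[OF D(1)]) (use assms in auto)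
  then have "hollow_frame (k * n) ?E 1 (real q * w)" by (rule hollow_frame_scale) (use assms in auto)
  moreover have "?E \<subseteq> zlattice (k * n)" using D(2) by auto
  ultimately obtain F where F: "hollow_frame d F 1 (real q * w)" "F \<subseteq> zlattice d"
    "simplex_frame (k * n) ?E \<Longrightarrow> simplex_frame d F"
    using hollow_frame_pyramid[OF _ _ assms(8)] by metis
  have d: "d \<ge> 1" using assms(2,6,8) by (metis le_trans mult_le_mono nat_mult_1)
  note * = hollow_frame_imp_polytope[OF F(1,2) d]
  show "ereal (real q * w) \<le> w_p d"
    unfolding w_p_def by (rule SUP_upper2[of "convex hull F"]) (use * in auto)
  assume "simplex_frame n A"
  then have "lattice_simplex d (convex hull F)"
    using *(4) F(3) D(3) simplex_frame_scale[of "k * n" D "real q"] assms(5) by simp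
  then show "ereal (real q * w) \<le> w_s d"
    unfolding w_s_def by (intro SUP_upper2[of "convex hull F"]) (use * in auto)
qed

section \<open>Rational approximation of convex bodies\<close>

lemma finite_grid:
  assumes "bounded K" "K \<subseteq> rspace d" "N \<ge> (1::nat)"
  shows "finite {x \<in> K. real N *\<^sub>R x \<in> zlattice d}"
proof -
  obtain B where B: "\<And>x. x \<in> K \<Longrightarrow> norm x \<le> B"
    using assms(1) by (auto simp: bounded_iff)
  define G where "G = {x \<in> K. real N *\<^sub>R x \<in> zlattice d}"
  define g where "g x = (\<lambda>i\<in>{..<d}. \<lfloor>real N * Poly_Mapping.lookup x i\<rfloor>)" for x :: "nat \<Rightarrow>\<^sub>0 real"
  have floor: "of_int \<lfloor>real N * Poly_Mapping.lookup x i\<rfloor> = real N * Poly_Mapping.lookup x i"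
    if "x \<in> G" for x i
    using that by (auto simp: G_def zlattice_def elim!: Ints_cases)
  have "inj_on g G"
  proof (rule inj_onI)
    fix x y assume xy: "x \<in> G" "y \<in> G" "g x = g y"
    have "Poly_Mapping.lookup x i = Poly_Mapping.lookup y i" for i
    proof (cases "i < d")
      case True
      then have "\<lfloor>real N * Poly_Mapping.lookup x i\<rfloor> = \<lfloor>real N * Poly_Mapping.lookup y i\<rfloor>"
        using fun_cong[OF xy(3), of i] by (simp add: g_def)
      then have "real N * Poly_Mapping.lookup x i = real N * Poly_Mapping.lookup y i"
        using floor xy by metis
      then show ?thesis using assms(3) by simp
    next
      case False
      then have "Poly_Mapping.lookup x i = 0" "Poly_Mapping.lookup y i = 0"
        using xy assms(2) by (auto simp: G_def rspace_iff)
      then show ?thesis by simp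
    qed
    then show "x = y" by (rule poly_mapping_eqI)
  qed
  moreover have "g ` G \<subseteq> (\<Pi>\<^sub>E i\<in>{..<d}. {- \<lceil>real N * B\<rceil>..\<lceil>real N * B\<rceil>})"
  proof (intro image_subsetI)
    fix x assume x: "x \<in> G"
    have "\<bar>Poly_Mapping.lookup x i\<bar> \<le> B" if "i < d" for i
    proof -
      have "x \<in> rspace d" using x assms(2) by (auto simp: G_def)
      then have "\<bar>Poly_Mapping.lookup x i\<bar> \<le> norm x"
        using that by (auto simp: norm_rspace intro!: member_le_sum)
      also have "norm x \<le> B" using x by (auto simp: G_def intro: B)
      finally show ?thesis .
    qed
    then have bound: "\<bar>real N * Poly_Mapping.lookup x i\<bar> \<le> real N * B" if "i < d" for i
      using that by (simp add: abs_mult mult_left_mono)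
    have "\<lfloor>real N * Poly_Mapping.lookup x i\<rfloor> \<in> {- \<lceil>real N * B\<rceil>..\<lceil>real N * B\<rceil>}" if "i < d" for i
      using bound[OF that] unfolding atLeastAtMost_iff by linarith
    then show "g x \<in> (\<Pi>\<^sub>E i\<in>{..<d}. {- \<lceil>real N * B\<rceil>..\<lceil>real N * B\<rceil>})"
      unfolding g_def by (intro restrict_PiE_iff[THEN iffD2]) auto
  qed
  ultimately show ?thesis
    unfolding G_def[symmetric]
    by (rule inj_on_finite) (intro finite_PiE finite_lessThan finite_atLeastAtMost_int)
qed

text \<open>Every coordinate is rounded in the direction that favours the functional \<open>a\<close>; this
  makes it unnecessary to know that the polytopes below contain a given subset of the body.\<close>

lemma round_to_grid:
  assumes "x \<in> rspace d" "N \<ge> (1::nat)"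
  obtains y where "y \<in> rspace d" "real N *\<^sub>R y \<in> zlattice d" "dist x y \<le> real d / real N"
    "pairing d a x \<le> pairing d a y"
proof
  define r where "r i = (if a i \<ge> 0 then \<lceil>real N * Poly_Mapping.lookup x i\<rceil>
    else \<lfloor>real N * Poly_Mapping.lookup x i\<rfloor>)" for i
  define y where "y = rvec d (\<lambda>i. of_int (r i) / real N)"
  have N: "real N > 0" using assms(2) by simp
  show y: "y \<in> rspace d" by (simp add: y_def)
  show "real N *\<^sub>R y \<in> zlattice d"
    using N y by (auto simp: zlattice_iff rspace_scaleR) (simp add: y_def)
  have r: "\<bar>real N * Poly_Mapping.lookup x i - of_int (r i)\<bar> \<le> 1" for i
    unfolding r_def by (auto simp: abs_le_iff) linarith+
  have "dist x y = (\<Sum>i<d. \<bar>Poly_Mapping.lookup x i - of_int (r i) / real N\<bar>)"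
    using norm_rspace[OF rspace_diff[OF assms(1) y]] by (simp add: dist_norm lookup_minus y_def)
  also have "\<dots> \<le> (\<Sum>i<d. 1 / real N)"
  proof (rule sum_mono)
    fix i
    have "\<bar>Poly_Mapping.lookup x i - of_int (r i) / real N\<bar>
        = \<bar>real N * Poly_Mapping.lookup x i - of_int (r i)\<bar> / real N"
      using N abs_divide[of "real N * Poly_Mapping.lookup x i - of_int (r i)" "real N"]
      by (simp add: diff_divide_distrib)
    then show "\<bar>Poly_Mapping.lookup x i - of_int (r i) / real N\<bar> \<le> 1 / real N"
      using r[of i] N by (simp add: divide_right_mono)
  qed
  finally show "dist x y \<le> real d / real N" by simp
  show "pairing d a x \<le> pairing d a y"
    unfolding pairing_def
  proof (rule sum_mono)
    fix i assume "i \<in> {..<d}"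
    then have y_i: "Poly_Mapping.lookup y i = of_int (r i) / real N" by (simp add: y_def)
    show "real_of_int (a i) * Poly_Mapping.lookup x i \<le> real_of_int (a i) * Poly_Mapping.lookup y i"
    proof (cases "a i \<ge> 0")
      case True
      then have "Poly_Mapping.lookup x i \<le> Poly_Mapping.lookup y i"
        using N by (simp add: y_i r_def pos_le_divide_eq mult.commute)
      then show ?thesis using True by (simp add: mult_left_mono)
    next
      case False
      then have "Poly_Mapping.lookup y i \<le> Poly_Mapping.lookup x i"
        using N by (simp add: y_i r_def pos_divide_le_eq mult.commute)
      then show ?thesis using False by (simp add: mult_left_mono_neg)
    qed
  qed
qed

text \<open>The convex hull of \<open>q \<plusminus> h e\<^sub>i\<close> is a ball of the norm of the ambient space.\<close>

lemma body_interior_cross_polytope: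
  assumes "convex P" "q \<in> rspace d" "h > 0" "q \<in> P"
    and cross: "\<And>i. i < d \<Longrightarrow> q + h *\<^sub>R Poly_Mapping.single i 1 \<in> P"
      "\<And>i. i < d \<Longrightarrow> q - h *\<^sub>R Poly_Mapping.single i 1 \<in> P"
  shows "q \<in> body_interior d P"
  unfolding body_interior_iff
proof (intro conjI exI[of _ h] ballI impI)
  fix y assume y: "y \<in> rspace d" "dist q y < h"
  define c where "c i = Poly_Mapping.lookup (y - q) i" for i
  have yq: "y - q \<in> rspace d" using y assms(2) by (intro rspace_diff)
  have sum_c: "(\<Sum>i<d. \<bar>c i\<bar>) < h"
    using y(2) norm_rspace[OF yq] by (simp add: c_def dist_norm norm_minus_commute)
  \<comment> \<open>The vertex in direction \<open>i\<close> gets weight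
    \<open>\<bar>c i\<bar> / h\<close> on the side given by the sign of \<open>c i\<close>; index
    \<open>d\<close> stands for the centre \<open>q\<close>, which takes the remaining
    weight.\<close>
  define u where "u i = (if i < d then \<bar>c i\<bar> / h else 1 - (\<Sum>i<d. \<bar>c i\<bar> / h))" for i
  define p where "p i = (if i < d then q + (sgn (c i) * h) *\<^sub>R Poly_Mapping.single i 1 else q)" for i
  have "(\<Sum>i\<le>d. u i *\<^sub>R p i) \<in> P"
  proof (rule convex_sum[OF _ assms(1)])
    show "(\<Sum>i\<le>d. u i) = 1"
      by (simp add: u_def flip: lessThan_Suc_atMost)
    show "u i \<ge> 0" for i
      using sum_c assms(3) by (simp add: u_def flip: sum_divide_distrib)
    show "p i \<in> P" for i
      using cross[of i] assms(4) by (auto simp: p_def sgn_if)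
  qed simp
  also have "(\<Sum>i\<le>d. u i *\<^sub>R p i)
      = (\<Sum>i<d. (\<bar>c i\<bar> / h) *\<^sub>R q + c i *\<^sub>R Poly_Mapping.single i 1) + (1 - (\<Sum>i<d. \<bar>c i\<bar> / h)) *\<^sub>R q"
    using assms(3)
    by (simp add: u_def p_def scaleR_add_right mult.assoc[symmetric] abs_mult_sgn flip: lessThan_Suc_atMost)
  also have "\<dots> = q + (\<Sum>i<d. c i *\<^sub>R Poly_Mapping.single i 1)"
    by (simp add: sum.distrib scaleR_sum_left algebra_simps)
  also have "\<dots> = y"
    using rspace_expand[OF yq] by (simp add: c_def)
  finally show "y \<in> P" .
qed (use assms in auto)

section \<open>Moving a lattice point to the origin\<close>

lemma body_interior_translation:
  assumes "x \<in> body_interior d K" "v \<in> rspace d"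
  shows "v + x \<in> body_interior d ((+) v ` K)"
proof -
  obtain e where e: "e > 0" "\<And>z. z \<in> rspace d \<Longrightarrow> dist x z < e \<Longrightarrow> z \<in> K" and x: "x \<in> rspace d"
    using assms(1) by (auto simp: body_interior_iff)
  have "y \<in> (+) v ` K" if "y \<in> rspace d" "dist (v + x) y < e" for y
  proof -
    have "y - v \<in> K"
      using that assms(2) by (intro e(2) rspace_diff) (auto simp: dist_norm algebra_simps)
    then show ?thesis by (intro image_eqI[of _ _ "y - v"]) auto
  qed
  then show ?thesis
    using e(1) x assms(2) by (auto simp: body_interior_iff intro: rspace_add)
qed

lemma hollow_translation:
  assumes "hollow d K" "v \<in> zlattice d"
  shows "hollow d ((+) v ` K)"
proof -
  have False if "x \<in> body_interior d ((+) v ` K)" "x \<in> zlattice d" for x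
  proof -
    have v: "- v \<in> zlattice d" "- v \<in> rspace d"
      using zlattice_diff[OF zlattice_zero assms(2)] by (auto simp: zlattice_iff)
    have "- v + x \<in> body_interior d ((+) (- v) ` (+) v ` K)"
      using that(1) v(2) by (rule body_interior_translation)
    moreover have "- v + x \<in> zlattice d" using v(1) that(2) by (rule zlattice_add)
    moreover have "(+) (- v) ` (+) v ` K = K" by (simp add: image_comp o_def)
    ultimately show False using assms(1) unfolding hollow_def by (metis disjoint_iff)
  qed
  then show ?thesis by (auto simp: hollow_def)
qed

lemma wide_translation:
  assumes "wide d C w"
  shows "wide d ((+) v ` C) w"
  unfolding wide_def
proof (intro allI impI)
  fix a :: "nat \<Rightarrow> int" assume "\<exists>i<d. a i \<noteq> 0"
  then obtain x y where "x \<in> C" "y \<in> C" "w \<le> pairing d a x - pairing d a y"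
    using assms unfolding wide_def by blast
  then show "\<exists>x\<in>(+) v ` C. \<exists>y\<in>(+) v ` C. w \<le> pairing d a x - pairing d a y"
    by (intro bexI[of _ "v + x"] bexI[of _ "v + y"]) (auto simp: linear_add[OF linear_pairing])
qed

lemma hollow_frame_translate:
  assumes "finite C" "C \<subseteq> rspace d" "z \<in> C" "z \<in> zlattice d"
    "body_interior d (convex hull C) \<noteq> {}" "hollow d (convex hull C)" "wide d C w"
  shows "hollow_frame d ((+) (- z) ` C) 1 w"
proof -
  have z: "- z \<in> zlattice d" "- z \<in> rspace d"
    using zlattice_diff[OF zlattice_zero assms(4)] by (auto simp: zlattice_iff)
  have hull: "convex hull ((+) (- z) ` C) = (+) (- z) ` (convex hull C)"
    by (rule convex_hull_translation)
  have "body_interior d (convex hull ((+) (- z) ` C)) \<noteq> {}"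
    unfolding hull using assms(5) z(2) body_interior_translation by fast
  moreover have "hollow d (convex hull ((+) (- z) ` C))"
    unfolding hull using assms(6) z(1) by (rule hollow_translation)
  moreover have "0 \<in> (+) (- z) ` C" using assms(3) by (auto simp: image_iff)
  moreover have "(+) (- z) ` C \<subseteq> rspace d" using assms(2) z(2) rspace_add[of "- z" d] by blast
  ultimately show ?thesis
    using assms(1) wide_translation[OF assms(7), of "- z"]
    by (simp add: hollow_frame_def del: add_uminus_conv_diff)
qed

lemma convex_hull_insertE:
  assumes "x \<in> convex hull (insert a S)" "S \<noteq> {}"
  obtains r k where "x = r *\<^sub>R a + (1 - r) *\<^sub>R k" "0 \<le> r" "r \<le> 1" "k \<in> convex hull S"
proof -
  obtain u v b where "u \<ge> 0" "v \<ge> 0" "u + v = 1" "b \<in> convex hull S" "x = u *\<^sub>R a + v *\<^sub>R b"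
    using assms(1) unfolding convex_hull_insert[OF assms(2)] by blast
  moreover from this have "v = 1 - u" by simp
  ultimately show ?thesis using that[of u b] by simp
qed

text \<open>A lattice point \<open>z\<close> for which the hull of \<open>P\<close> and \<open>z\<close> has the fewest lattice points will do:
  an interior lattice point \<open>z'\<close> of the hull would be a better choice, as \<open>z\<close> is not in the hull
  of \<open>P\<close> and \<open>z'\<close>.\<close>

lemma hollow_insert_lattice_point:
  assumes "finite C" "C \<noteq> {}" "C \<subseteq> rspace d" "hollow d (convex hull C)"
  obtains z where "z \<in> zlattice d" "hollow d (convex hull (insert z C))"
proof -
  define L where "L z = convex hull (insert z C) \<inter> zlattice d" for z
  have finL: "finite (L z)" if "z \<in> zlattice d" for z
  proof -
    have "insert z C \<subseteq> rspace d" using that assms(3) by (auto simp: zlattice_iff)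
    then have "finite {x \<in> convex hull (insert z C). real 1 *\<^sub>R x \<in> zlattice d}"
      using assms(1) by (intro finite_grid bounded_convex_hull_finite convex_hull_subset_rspace) auto
    then show ?thesis by (rule rev_finite_subset) (auto simp: L_def)
  qed
  obtain z where z: "z \<in> zlattice d" "\<And>y. y \<in> zlattice d \<Longrightarrow> card (L z) \<le> card (L y)"
    using ex_has_least_nat[of "\<lambda>z. z \<in> zlattice d" 0 "\<lambda>z. card (L z)"] by auto
  let ?P = "convex hull C"
  obtain k0 where k0: "k0 \<in> C" "k0 \<in> ?P" using assms(2) by (auto intro: hull_inc)
  have "hollow d (convex hull (insert z C))"
  proof (cases "z \<in> ?P")
    case True
    then have "convex hull (insert z C) = ?P" by (simp add: hull_redundant)
    then show ?thesis using assms(4) by simp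
  next
    case False
    have False if y: "y \<in> body_interior d (convex hull (insert z C))" "y \<in> zlattice d" for y
    proof -
      \<comment> \<open>Pushing \<open>y\<close> away from a point of \<open>?P\<close> shows that
        the weight of \<open>z\<close> in \<open>y\<close> can be taken to be
        \<open>r / (1 + \<delta>) < 1\<close>.\<close>
      obtain \<delta> where \<delta>: "\<delta> > 0" "y + \<delta> *\<^sub>R (y - k0) \<in> convex hull (insert z C)"
        using body_interior_extend[OF y(1)] k0 assms(3) by blast
      then obtain r k where rk: "y + \<delta> *\<^sub>R (y - k0) = r *\<^sub>R z + (1 - r) *\<^sub>R k" "0 \<le> r" "r \<le> 1" "k \<in> ?P"
        using convex_hull_insertE[OF _ assms(2)] by metis
      obtain k' where k': "k' \<in> ?P" "(1 - r) *\<^sub>R k + \<delta> *\<^sub>R k0 = (1 - r + \<delta>) *\<^sub>R k'"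
        using convex_scaled_add[OF convex_convex_hull, of "1 - r" \<delta> k C k0] rk \<delta> k0 by auto
      have ymul: "(1 + \<delta>) *\<^sub>R y = r *\<^sub>R z + (1 - r + \<delta>) *\<^sub>R k'"
        using rk(1) unfolding k'(2)[symmetric] by (simp add: algebra_simps)
      \<comment> \<open>Otherwise, substituting the expression for \<open>y\<close> and solving for
        \<open>z\<close> would put \<open>z\<close> into \<open>?P\<close>; the factor
        \<open>1 + \<delta> - u * r\<close> is positive.\<close>
      have "z \<notin> convex hull (insert y C)"
      proof
        assume "z \<in> convex hull (insert y C)"
        then obtain u k'' where u: "z = u *\<^sub>R y + (1 - u) *\<^sub>R k''" "0 \<le> u" "u \<le> 1" "k'' \<in> ?P"
          using convex_hull_insertE[OF _ assms(2)] by metis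
        obtain k3 where k3: "k3 \<in> ?P" "(u * (1 - r + \<delta>)) *\<^sub>R k' + ((1 + \<delta>) * (1 - u)) *\<^sub>R k''
            = (u * (1 - r + \<delta>) + (1 + \<delta>) * (1 - u)) *\<^sub>R k3"
          using convex_scaled_add[OF convex_convex_hull, of "u * (1 - r + \<delta>)" "(1 + \<delta>) * (1 - u)" k' C k'']
            rk \<delta> u k' by auto
        have "(1 + \<delta>) *\<^sub>R z = u *\<^sub>R ((1 + \<delta>) *\<^sub>R y) + ((1 + \<delta>) * (1 - u)) *\<^sub>R k''"
          by (subst u(1)) (simp add: scaleR_add_right mult.commute)
        also have "\<dots> = (u * r) *\<^sub>R z + (u * (1 - r + \<delta>) + (1 + \<delta>) * (1 - u)) *\<^sub>R k3"
          by (simp add: ymul scaleR_add_right k3(2)[symmetric])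
        also have "u * (1 - r + \<delta>) + (1 + \<delta>) * (1 - u) = 1 + \<delta> - u * r"
          by (simp add: algebra_simps)
        finally have "(1 + \<delta> - u * r) *\<^sub>R z = (1 + \<delta> - u * r) *\<^sub>R k3"
          by (simp add: algebra_simps)
        moreover have "u * r \<le> 1" using u rk by (simp add: mult_le_one)
        then have "1 + \<delta> - u * r \<noteq> 0" using \<delta>(1) by linarith
        ultimately have "z = k3" by simp
        then show False using k3(1) False by simp
      qed
      moreover have "y \<in> convex hull (insert z C)"
        using y(1) body_interior_subset by blast
      then have "convex hull (insert y C) \<subseteq> convex hull (insert z C)"
        by (intro hull_minimal) (auto intro: hull_inc)
      moreover have "z \<in> L z" using z(1) by (auto simp: L_def intro: hull_inc)
      ultimately have "L y \<subset> L z" unfolding L_def by blast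
      then have "card (L y) < card (L z)" by (intro psubset_card_mono finL z(1))
      with z(2)[OF y(2)] show False by simp
    qed
    then show ?thesis by (auto simp: hollow_def)
  qed
  with z(1) that show ?thesis by blast
qed

text \<open>\<open>C\<close> consists of all points of \<open>K\<close> with denominator
  \<open>N\<close>. Shrinking \<open>K\<close> towards an interior point by the factor
  \<open>1 - \<epsilon>\<close> leaves room for rounding to that grid, so the width drops by no more
  than this factor, chosen as \<open>w' / w\<close>.\<close>

lemma convex_body_imp_hollow_frame:
  assumes "convex_body n K" "hollow n K" "wide n K w" "0 < w'" "w' < w"
  obtains A N where "N \<ge> (1::nat)" "hollow_frame n A 1 w'" "\<forall>x\<in>A. real N *\<^sub>R x \<in> zlattice n"
proof -
  have K: "K \<subseteq> rspace n" "bounded K" "convex K"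
    using assms(1) by (auto simp: convex_body_def compact_imp_bounded)
  obtain p where "p \<in> body_interior n K"
    using assms(1) by (auto simp: convex_body_def)
  then obtain e where p: "p \<in> rspace n" and e: "e > 0"
    "\<And>z. z \<in> rspace n \<Longrightarrow> dist p z < e \<Longrightarrow> z \<in> K"
    by (auto simp: body_interior_iff)
  define \<epsilon> where "\<epsilon> = 1 - w' / w"
  have \<epsilon>: "0 < \<epsilon>" "\<epsilon> < 1" "(1 - \<epsilon>) * w = w'"
    using assms by (auto simp: \<epsilon>_def)
  \<comment> \<open>Of \<open>(n + 1) / N\<close>, the part \<open>n / N\<close> pays for rounding
    and \<open>1 / N\<close> for a cross-polytope around the rounded centre.\<close>
  obtain N :: nat where N: "real N > (real n + 1) / (\<epsilon> * e)" using reals_Archimedean2 by blast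
  have "0 < (real n + 1) / (\<epsilon> * e)" using \<epsilon> e(1) by simp
  with N have N0: "real N > 0" by linarith
  have Nn: "(real n + 1) / real N < \<epsilon> * e"
    using N N0 \<epsilon> e(1) by (simp add: field_simps)
  have "\<epsilon> * e < 1 * e" using \<epsilon> e(1) by (intro mult_strict_right_mono) auto
  with Nn have Nn': "real n / real N + 1 / real N < e" by (simp add: add_divide_distrib)
  have N1: "N \<ge> 1" using N0 by simp
  define C where "C = {x \<in> K. real N *\<^sub>R x \<in> zlattice n}"
  have C: "finite C" "C \<subseteq> K" using finite_grid[OF K(2,1) N1] by (auto simp: C_def)
  have CK: "convex hull C \<subseteq> K" using C(2) K(3) by (rule hull_minimal)
  have shrunk: "\<exists>y\<in>C. (1 - \<epsilon>) * pairing n a x + \<epsilon> * pairing n a p \<le> pairing n a y"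
    if x: "x \<in> K" for x a
  proof -
    define x' where "x' = (1 - \<epsilon>) *\<^sub>R x + \<epsilon> *\<^sub>R p"
    have x': "x' \<in> rspace n" using x K p by (auto simp: x'_def intro!: rspace_add rspace_scaleR)
    obtain y where y: "y \<in> rspace n" "real N *\<^sub>R y \<in> zlattice n" "dist x' y \<le> real n / real N"
      "pairing n a x' \<le> pairing n a y"
      using round_to_grid[OF x' N1] by blast
    have "real n / real N \<le> (real n + 1) / real N" using N0 by (simp add: divide_right_mono)
    with y(3) Nn have d: "dist x' y < \<epsilon> * e" by linarith
    \<comment> \<open>Chosen to make \<open>y\<close> equal to
      \<open>(1 - \<epsilon>) *\<^sub>R x + \<epsilon> *\<^sub>R v\<close>: the rounding error,
      magnified by \<open>1 / \<epsilon>\<close>, still keeps \<open>v\<close> within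
      \<open>e\<close> of \<open>p\<close>.\<close>
    define v where "v = p + (1 / \<epsilon>) *\<^sub>R (y - x')"
    have "dist p v = dist x' y / \<epsilon>"
      using \<epsilon> by (simp add: v_def dist_norm norm_minus_commute)
    also have "\<dots> < e" using d \<epsilon> by (simp add: pos_divide_less_eq mult.commute)
    finally have "v \<in> K"
      using p x' y by (intro e(2)) (auto simp: v_def intro!: rspace_add rspace_scaleR rspace_diff)
    then have "(1 - \<epsilon>) *\<^sub>R x + \<epsilon> *\<^sub>R v \<in> K"
      using \<epsilon> x K(3) by (intro convexD) auto
    moreover have "(1 - \<epsilon>) *\<^sub>R x + \<epsilon> *\<^sub>R v = y"
      using \<epsilon> by (simp add: v_def x'_def scaleR_add_right)
    ultimately have "y \<in> C" using y by (simp add: C_def)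
    moreover have "pairing n a x' = (1 - \<epsilon>) * pairing n a x + \<epsilon> * pairing n a p"
      by (simp add: x'_def linear_add[OF linear_pairing] linear_cmul[OF linear_pairing])
    ultimately show ?thesis using y(4) by auto
  qed
  have wideC: "wide n C w'"
    unfolding wide_def
  proof (intro allI impI)
    fix a :: "nat \<Rightarrow> int" assume "\<exists>i<n. a i \<noteq> 0"
    then obtain x y where xy: "x \<in> K" "y \<in> K" "w \<le> pairing n a x - pairing n a y"
      using assms(3) unfolding wide_def by blast
    have neg: "pairing n (\<lambda>i. - a i) z = - pairing n a z" for z
      by (simp add: pairing_def sum_negf)
    obtain x' where x': "x' \<in> C" "(1 - \<epsilon>) * pairing n a x + \<epsilon> * pairing n a p \<le> pairing n a x'"
      using shrunk[OF xy(1)] by blast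
    \<comment> \<open>The lower end is the upper end for the negated functional; the terms with
      \<open>p\<close> cancel in the difference.\<close>
    obtain y' where y': "y' \<in> C"
      "pairing n a y' \<le> (1 - \<epsilon>) * pairing n a y + \<epsilon> * pairing n a p"
      using shrunk[OF xy(2), of "\<lambda>i. - a i"] unfolding neg by auto
    have "w' \<le> (1 - \<epsilon>) * (pairing n a x - pairing n a y)"
      unfolding \<epsilon>(3)[symmetric] using \<epsilon>(2) xy(3) by (intro mult_left_mono) auto
    also have "\<dots> \<le> pairing n a x' - pairing n a y'"
      using x'(2) y'(2) by (simp add: algebra_simps)
    finally show "\<exists>x\<in>C. \<exists>y\<in>C. w' \<le> pairing n a x - pairing n a y"
      using x'(1) y'(1) by blast
  qed
  \<comment> \<open>A grid point near \<open>p\<close>: its neighbours at distance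
    \<open>1 / N\<close> along the axes are grid points of \<open>K\<close> as well, so the hull of
    \<open>C\<close> has interior.\<close>
  obtain q where q: "q \<in> rspace n" "real N *\<^sub>R q \<in> zlattice n" "dist p q \<le> real n / real N"
    using round_to_grid[OF p N1] by metis
  have inC: "y \<in> C" if y: "y \<in> rspace n" "real N *\<^sub>R y \<in> zlattice n" "dist q y \<le> 1 / real N" for y
  proof -
    have "dist p y < e" using dist_triangle[of p y q] y(3) q(3) Nn' by linarith
    then show ?thesis using y e(2) by (simp add: C_def)
  qed
  have qC: "q \<in> C" using q by (intro inC) auto
  have "q \<in> body_interior n (convex hull C)"
  proof (rule body_interior_cross_polytope)
    fix i assume i: "i < n"
    let ?e = "Poly_Mapping.single i 1 :: nat \<Rightarrow>\<^sub>0 real"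
    have e: "?e \<in> zlattice n" using i by (auto simp: zlattice_iff rspace_iff lookup_single when_def)
    then have er: "?e \<in> rspace n" by (simp add: zlattice_iff)
    have "norm ?e = 1"
      by (simp add: norm_poly_mapping_def dist_poly_mapping_def)
    then have "q + (1 / real N) *\<^sub>R ?e \<in> C" "q - (1 / real N) *\<^sub>R ?e \<in> C"
      using q e er N0
      by (intro inC; auto simp: scaleR_add_right scaleR_diff_right dist_norm
          intro!: rspace_add rspace_diff rspace_scaleR zlattice_add zlattice_diff)+
    then show "q + (1 / real N) *\<^sub>R ?e \<in> convex hull C" "q - (1 / real N) *\<^sub>R ?e \<in> convex hull C"
      by (auto intro: hull_inc)
  qed (use q qC N0 in \<open>auto intro: hull_inc\<close>)
  moreover obtain z where z: "z \<in> zlattice n" "hollow n (convex hull (insert z C))"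
    using hollow_insert_lattice_point[of C n] C qC K(1) hollow_mono[OF assms(2) CK] by blast
  ultimately have ne: "body_interior n (convex hull (insert z C)) \<noteq> {}"
    using body_interior_mono[OF hull_mono[OF subset_insertI]] by blast
  have "hollow_frame n ((+) (- z) ` insert z C) 1 w'"
  proof (rule hollow_frame_translate)
    show "wide n (insert z C) w'" using wideC by (rule wide_mono) auto
  qed (use C K z ne in \<open>auto simp: zlattice_iff\<close>)
  moreover have "real N *\<^sub>R x \<in> zlattice n" if "x \<in> (+) (- z) ` insert z C" for x
  proof -
    from that obtain y where "x = - z + y" and y: "y \<in> insert z C" by blast
    then have x: "x = y - z" by simp
    have Nz: "real N *\<^sub>R z \<in> zlattice n"
      using z(1) by (auto simp: zlattice_iff rspace_scaleR)
    then have "real N *\<^sub>R y \<in> zlattice n" using y by (auto simp: C_def)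
    with Nz show ?thesis by (simp add: x scaleR_diff_right zlattice_diff)
  qed
  ultimately show ?thesis using that N1 by blast
qed

section \<open>Asymptotic behaviour of the widths\<close>

text \<open>With \<open>j = d div p\<close>, the dimensions lost to the remainder lower the quotient
  by at most \<open>r / d\<close>, which tends to 0.\<close>

lemma liminf_quotient_ge:
  fixes F :: "nat \<Rightarrow> ereal" and p :: nat
  assumes "p \<ge> 1" "r \<ge> 0" "\<And>j d. j \<ge> 1 \<Longrightarrow> d \<ge> j * p \<Longrightarrow> ereal (real j * r) \<le> F d"
  shows "ereal (r / p) \<le> liminf (\<lambda>d. F d / ereal (real d))"
proof -
  have "(\<lambda>d. r / p - r / real d) \<longlonglongrightarrow> r / p - 0"
    by (intro tendsto_intros lim_const_over_n)
  then have "(\<lambda>d. ereal (r / p - r / real d)) \<longlonglongrightarrow> ereal (r / p)"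
    by simp
  then have "ereal (r / p) = liminf (\<lambda>d. ereal (r / p - r / real d))"
    by (intro lim_imp_Liminf[symmetric]) auto
  also have "\<dots> \<le> liminf (\<lambda>d. F d / ereal (real d))"
  proof (intro Liminf_mono eventually_sequentiallyI[of p])
    fix d assume d: "d \<ge> p"
    then have d0: "real d > 0" using assms(1) by linarith
    define j where "j = d div p"
    have j: "j \<ge> 1" "j * p \<le> d" "d < j * p + p"
      using d assms(1) div_greater_zero_iff[of d p] dividend_less_times_div[of p d]
      by (auto simp: j_def algebra_simps)
    have "real d < real j * real p + real p"
      using j(3) by (metis of_nat_add of_nat_less_iff of_nat_mult)
    then have "real d / p - 1 \<le> real j"
      using assms(1) by (simp add: field_simps)
    then have "(real d / p - 1) * r \<le> real j * r"
      using assms(2) by (rule mult_right_mono)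
    then have "(real d / p - 1) * r / real d \<le> real j * r / real d"
      using d0 by (simp add: divide_right_mono)
    moreover have "(real d / p - 1) * r / real d = r / p - r / real d"
      using d0 by (simp add: left_diff_distrib diff_divide_distrib)
    ultimately have "r / p - r / real d \<le> real j * r / real d" by simp
    then have "ereal (r / p - r / real d) \<le> ereal (real j * r) / ereal (real d)"
      using d0 by simp
    also have "\<dots> \<le> F d / ereal (real d)"
      using d0 j assms(3) by (intro ereal_divide_right_mono) auto
    finally show "ereal (r / p - r / real d) \<le> F d / ereal (real d)" .
  qed
  finally show ?thesis .
qed

text \<open>With parameter 1, \<open>j * N\<close> summands permit dilation by \<open>j * N\<close>;
  the denominator \<open>N\<close> cancels in the quotient.\<close>

lemma hollow_frame_liminf_w_p:
  assumes "hollow_frame n A 1 w" "n \<ge> 1" "w \<ge> 0" "N \<ge> (1::nat)" "\<forall>x\<in>A. real N *\<^sub>R x \<in> zlattice n"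
  shows "ereal (w / n) \<le> liminf (\<lambda>d. w_p d / ereal (real d))"
proof -
  have "ereal (real j * (real N * w)) \<le> w_p d" if "j \<ge> 1" "d \<ge> j * (N * n)" for j d
  proof -
    have "real (j * N) *\<^sub>R x \<in> zlattice n" if "x \<in> A" for x
      using assms(5) that by (auto simp: zlattice_iff rspace_scaleR mult.assoc)
        (metis assms(5) lookup_scaleR rspace_scaleR scaleR_scaleR zlattice_iff)+
    then have "ereal (real (j * N) * w) \<le> w_p d"
      using assms that by (intro hollow_frame_lower_bound(1)[OF assms(1), of "j * N" "j * N"]) (auto simp: mult.assoc)
    then show ?thesis by (simp add: mult.assoc)
  qed
  then have "ereal (real N * w / real (N * n)) \<le> liminf (\<lambda>d. w_p d / ereal (real d))"
    using assms by (intro liminf_quotient_ge) auto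
  then show ?thesis using assms(4) by simp
qed

text \<open>Witnesses exist only below the width, hence this passage to the limit. A number between
  \<open>L\<close> and \<open>W / n\<close> is positive because \<open>L\<close> is
  nonnegative.\<close>

lemma ereal_le_by_smaller:
  assumes "0 \<le> L" "\<And>w. 0 < w \<Longrightarrow> w < W \<Longrightarrow> ereal (w / n) \<le> L" "n > (0::real)"
  shows "ereal (W / n) \<le> L"
proof (rule ccontr)
  assume "\<not> ?thesis"
  then obtain c where c: "L < ereal c" "ereal c < ereal (W / n)"
    using ereal_dense2[of L "ereal (W / n)"] by (auto simp: not_le)
  have "0 < c" using assms(1) c(1) by (metis ereal_less(2) order_le_less_trans)
  then have "ereal (c * n / n) \<le> L"
    using c(2) assms(3) by (intro assms(2)) (auto simp: field_simps)
  with c(1) assms(3) show False by simp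
qed

lemma liminf_w_p_nonneg: "0 \<le> liminf (\<lambda>d. w_p d / ereal (real d))"
proof -
  have "hollow_frame 1 (axis_segment 1) 1 1" using hollow_frame_axis_segment[of 1] by simp
  moreover have "\<forall>x\<in>axis_segment 1. real 1 *\<^sub>R x \<in> zlattice 1"
    by (auto simp: axis_segment_def zlattice_iff rspace_iff lookup_one when_def)
  ultimately have "ereal (1 / real 1) \<le> liminf (\<lambda>d. w_p d / ereal (real d))"
    by (intro hollow_frame_liminf_w_p) auto
  then show ?thesis by (rule order_trans[rotated]) simp
qed

lemma w_c_le_liminf_w_p:
  assumes "n \<ge> 1"
  shows "w_c n / ereal (real n) \<le> liminf (\<lambda>d. w_p d / ereal (real d))"
proof -
  let ?L = "liminf (\<lambda>d. w_p d / ereal (real d))"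
  have "ereal (lattice_width n K / real n) \<le> ?L" if K: "convex_body n K" "hollow n K" for K
  proof (rule ereal_le_by_smaller[OF liminf_w_p_nonneg])
    fix w assume w: "0 < w" "w < lattice_width n K"
    \<comment> \<open>Two gaps are needed: one below the width for witnesses, one for the rational
      approximation.\<close>
    then obtain w' where w': "w < w'" "w' < lattice_width n K" using dense by blast
    have "wide n K w'"
      using w'(2) K(1) body_interior_subset[of n K]
      by (intro less_lattice_width_imp) (auto simp: convex_body_def compact_imp_bounded)
    then obtain A N where "N \<ge> (1::nat)" "hollow_frame n A 1 w" "\<forall>x\<in>A. real N *\<^sub>R x \<in> zlattice n"
      using convex_body_imp_hollow_frame[OF K _ w(1) w'(1)] by blast
    then show "ereal (w / real n) \<le> ?L"
      using assms w by (intro hollow_frame_liminf_w_p) auto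
  qed (use assms in auto)
  then have "w_c n \<le> ereal (real n) * ?L"
    unfolding w_c_def using assms
    by (intro SUP_least) (auto simp flip: ereal_divide_le_pos)
  then show ?thesis using assms by (simp add: ereal_divide_le_pos)
qed

text \<open>A lattice simplex needs neither approximation nor an extra point: any of its vertices
  serves as origin.\<close>

lemma w_s_le_liminf_w_s:
  assumes "n \<ge> 1" "0 \<le> liminf (\<lambda>d. w_s d / ereal (real d))"
  shows "w_s n / ereal (real n) \<le> liminf (\<lambda>d. w_s d / ereal (real d))"
proof -
  let ?L = "liminf (\<lambda>d. w_s d / ereal (real d))"
  have "ereal (lattice_width n P / real n) \<le> ?L" if P: "lattice_simplex n P" "hollow n P" for P
  proof (rule ereal_le_by_smaller[OF assms(2)])
    fix w assume w: "0 < w" "w < lattice_width n P"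
    obtain C where C: "\<not> affine_dependent C" "card C = n + 1" "P = convex hull C"
      and P': "P \<subseteq> rspace n" "body_interior n P \<noteq> {}" "{v. v extreme_point_of P} \<subseteq> zlattice n"
      using P(1) by (auto simp: lattice_simplex_def lattice_polytope_def)
    have fin: "finite C" using C(2) by (simp add: card_ge_0_finite)
    \<comment> \<open>Integrality is given for extreme points only; by affine independence they
      include all of \<open>C\<close>.\<close>
    have "v extreme_point_of P" if v: "v \<in> C" for v
    proof -
      have "v \<notin> convex hull (C - {v})"
        using C(1) v convex_hull_subset_affine_hull[of "C - {v}"] by (auto simp: affine_dependent_def)
      then show ?thesis
        using extreme_point_of_convex_hull_insert[of "C - {v}" v] fin v by (simp add: C(3) insert_absorb)
    qed
    then have CZ: "C \<subseteq> zlattice n" using P'(3) by blast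
    have CP: "C \<subseteq> P" by (simp add: C(3) hull_subset)
    obtain z where z: "z \<in> C" using C(2) by fastforce
    have "wide n P w"
      using w(2) P' CP z fin
      by (intro less_lattice_width_imp) (auto simp: C(3) bounded_convex_hull_finite)
    then have "wide n C w" unfolding C(3) by (rule wide_convex_hull)
    let ?A = "(+) (- z) ` C"
    have "hollow_frame n ?A 1 w"
      using fin CP P' z CZ P(2) \<open>wide n C w\<close>
      by (intro hollow_frame_translate) (auto simp: C(3))
    moreover have "simplex_frame n ?A"
    proof -
      have "?A - {0} = (\<lambda>x. - z + x) ` (C - {z})" by auto
      moreover have "card ?A = card C" by (simp add: card_image)
      ultimately show ?thesis
        using C(1,2) affine_dependent_iff_dependent2[OF z] by (simp add: simplex_frame_def)
    qed
    moreover have "real j *\<^sub>R x \<in> zlattice n" if "x \<in> ?A" for x j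
    proof -
      have "x \<in> zlattice n"
        using that zlattice_diff[of _ n z] CZ z by auto
      then show ?thesis by (auto simp: zlattice_iff rspace_scaleR)
    qed
    ultimately have "ereal (real j * w) \<le> w_s d" if "j \<ge> 1" "d \<ge> j * n" for j d
      using that assms(1) by (intro hollow_frame_lower_bound(2)[of n ?A 1 w j j]) auto
    then show "ereal (w / real n) \<le> ?L"
      using assms(1) w by (intro liminf_quotient_ge) auto
  qed (use assms in auto)
  then have "w_s n \<le> ereal (real n) * ?L"
    unfolding w_s_def using assms
    by (intro SUP_least) (auto simp flip: ereal_divide_le_pos)
  then show ?thesis using assms by (simp add: ereal_divide_le_pos)
qed

text \<open>From \<open>f \<le> g \<le> liminf f\<close> all four lower and upper limits
  coincide.\<close>

lemma convergent_of_le_liminf: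
  fixes f g :: "nat \<Rightarrow> ereal"
  assumes "\<And>n. n \<ge> 1 \<Longrightarrow> g n \<le> liminf f" "\<And>n. n \<ge> 1 \<Longrightarrow> f n \<le> g n"
  shows "f \<longlonglongrightarrow> liminf f" "g \<longlonglongrightarrow> liminf f"
proof -
  have ev: "eventually (\<lambda>n. g n \<le> liminf f) sequentially" "eventually (\<lambda>n. f n \<le> g n) sequentially"
    using assms by (auto intro: eventually_sequentiallyI[of 1])
  have "limsup g \<le> liminf f" using ev(1) by (rule Limsup_bounded)
  moreover have "liminf f \<le> liminf g" "limsup f \<le> limsup g"
    using ev(2) by (auto intro: Liminf_mono Limsup_mono)
  moreover have "liminf f \<le> limsup f" "liminf g \<le> limsup g"
    by (simp_all add: Liminf_le_Limsup)
  ultimately have "limsup f = liminf f" "liminf g = liminf f" "limsup g = liminf f"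
    by auto
  then show "f \<longlonglongrightarrow> liminf f" "g \<longlonglongrightarrow> liminf f"
    by (auto intro: Liminf_eq_Limsup)
qed

lemma w_p_le_w_c: "w_p d \<le> w_c d"
  unfolding w_p_def w_c_def
proof (rule SUP_subset_mono)
  show "{P. lattice_polytope d P \<and> hollow d P} \<subseteq> {K. convex_body d K \<and> hollow d K}"
    by (auto simp: lattice_polytope_def convex_body_def polytope_def finite_imp_compact_convex_hull)
qed simp

section \<open>The simplex of Haase and Ziegler\<close>

lemma convex_combination_list:
  assumes "\<And>i. i < length ps \<Longrightarrow> u i \<ge> 0" "(\<Sum>i<length ps. u i) = 1"
  shows "(\<Sum>i<length ps. u i *\<^sub>R ps ! i) \<in> convex hull (set ps)"
  using assms by (intro convex_sum) (auto intro: hull_inc)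

lemma body_interior_hull_less:
  assumes "x \<in> body_interior d ((*\<^sub>R) t ` (convex hull C))" "t > 0" "linear f"
    "\<And>y. y \<in> C \<Longrightarrow> f y \<le> c" "v \<in> rspace d" "f v \<noteq> (0::real)"
  shows "f x < t * c"
proof (rule body_interior_functional_less[OF assms(1,3) _ assms(5,6)])
  fix y assume "y \<in> (*\<^sub>R) t ` (convex hull C)"
  then obtain z where z: "z \<in> convex hull C" "y = t *\<^sub>R z" by blast
  obtain z' where "z' \<in> C" "f z \<le> f z'" using convex_hull_linear_le[OF assms(3) z(1)] by blast
  then have "f z \<le> c" using assms(4) by fastforce
  then show "f y \<le> t * c"
    using assms(2) by (simp add: z(2) linear_cmul[OF assms(3)])
qed

lemma not_in_span_if_functional:
  assumes "linear f" "\<And>y. y \<in> S \<Longrightarrow> f y = (0::real)" "f x \<noteq> 0"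
  shows "x \<notin> span S"
  using linear_eq_0_on_span[OF assms(1,2)] assms(3) by blast

definition point :: "real list \<Rightarrow> (nat \<Rightarrow>\<^sub>0 real)" where
  "point xs = rvec (length xs) ((!) xs)"

lemma lookup_point: "Poly_Mapping.lookup (point xs) i = (if i < length xs then xs ! i else 0)"
  by (simp add: point_def)

lemma point_in_rspace: "length xs = d \<Longrightarrow> point xs \<in> rspace d"
  by (auto simp: point_def)

lemma zlattice_lookup:
  assumes "x \<in> zlattice d"
  obtains k :: "nat \<Rightarrow> int" where "\<And>i. Poly_Mapping.lookup x i = of_int (k i)"
  using assms that[of "\<lambda>i. \<lfloor>Poly_Mapping.lookup x i\<rfloor>"] by (auto simp: zlattice_def elim!: Ints_cases)

lemma sum_lessThan_4: "(\<Sum>i<4::nat. f i) = f 0 + f 1 + f 2 + (f 3 :: 'a::comm_monoid_add)"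
  by (simp add: numeral_eq_Suc)

lemma sum_lessThan_5: "(\<Sum>i<5::nat. f i) = f 0 + f 1 + f 2 + f 3 + (f 4 :: 'a::comm_monoid_add)"
  by (simp add: numeral_eq_Suc)

lemma lt_4_cases: "(i::nat) < 4 \<Longrightarrow> i = 0 \<or> i = 1 \<or> i = 2 \<or> i = 3" by auto
lemma lt_3_cases: "(i::nat) < 3 \<Longrightarrow> i = 0 \<or> i = 1 \<or> i = 2" by auto

lemma pairing_4:
  "pairing 4 a x = of_int (a 0) * Poly_Mapping.lookup x 0 + of_int (a 1) * Poly_Mapping.lookup x 1
    + of_int (a 2) * Poly_Mapping.lookup x 2 + of_int (a 3) * Poly_Mapping.lookup x 3"
  by (simp add: pairing_def numeral_eq_Suc)

lemma pairing_3:
  "pairing 3 a x = of_int (a 0) * Poly_Mapping.lookup x 0 + of_int (a 1) * Poly_Mapping.lookup x 1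
    + of_int (a 2) * Poly_Mapping.lookup x 2"
  by (simp add: pairing_def numeral_eq_Suc)

text \<open>The empty simplex of width 4 and normalized volume 101 found by Haase and Ziegler. With a vertex
  at the origin, barycentric coordinates of lattice points are multiples of 1/101, so that emptiness
  allows a dilation by 102/101.\<close>

definition haase_ziegler :: "(nat \<Rightarrow>\<^sub>0 real) list" where
  "haase_ziegler = [point [1,0,0,0], point [0,1,0,0], point [0,0,1,0], point [6,14,17,101], point [0,0,0,0]]"

lemma haase_ziegler_subset: "set haase_ziegler \<subseteq> zlattice 4"
  by (auto simp: haase_ziegler_def zlattice_iff point_in_rspace lookup_point dest!: lt_4_cases)

lemma haase_ziegler_zero: "0 \<in> set haase_ziegler"
proof -
  have "point [0,0,0,0] = 0"
    by (rule poly_mapping_eqI) (auto simp: lookup_point nth_Cons')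
  then show ?thesis by (simp add: haase_ziegler_def)
qed

lemma haase_ziegler_hullI:
  assumes "x \<in> rspace 4"
    and "Poly_Mapping.lookup x 3 \<ge> 0"
    and "101 * Poly_Mapping.lookup x 0 - 6 * Poly_Mapping.lookup x 3 \<ge> 0"
    and "101 * Poly_Mapping.lookup x 1 - 14 * Poly_Mapping.lookup x 3 \<ge> 0"
    and "101 * Poly_Mapping.lookup x 2 - 17 * Poly_Mapping.lookup x 3 \<ge> 0"
    and "101 * (Poly_Mapping.lookup x 0 + Poly_Mapping.lookup x 1 + Poly_Mapping.lookup x 2)
      - 36 * Poly_Mapping.lookup x 3 \<le> 101"
  shows "x \<in> convex hull (set haase_ziegler)"
proof -
  let ?x = "Poly_Mapping.lookup x"
  \<comment> \<open>The barycentric coordinates, the last one belonging to the origin.\<close>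
  define us where "us = [?x 0 - 6 * ?x 3 / 101, ?x 1 - 14 * ?x 3 / 101, ?x 2 - 17 * ?x 3 / 101, ?x 3 / 101,
    1 - (?x 0 + ?x 1 + ?x 2) + 36 * ?x 3 / 101]"
  have len: "length haase_ziegler = 5" by (simp add: haase_ziegler_def)
  have "(\<Sum>i<length haase_ziegler. us ! i *\<^sub>R haase_ziegler ! i) \<in> convex hull (set haase_ziegler)"
  proof (rule convex_combination_list)
    show "us ! i \<ge> 0" if "i < length haase_ziegler" for i
    proof -
      have "i = 0 \<or> i = 1 \<or> i = 2 \<or> i = 3 \<or> i = 4" using that len by auto
      then show ?thesis using assms(2-) by (auto simp: us_def)
    qed
    show "(\<Sum>i<length haase_ziegler. us ! i) = 1"
      unfolding len sum_lessThan_5 by (simp add: us_def field_simps)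
  qed
  also have "(\<Sum>i<length haase_ziegler. us ! i *\<^sub>R haase_ziegler ! i) = x"
  proof (rule poly_mapping_eqI)
    fix j
    have "Poly_Mapping.lookup (\<Sum>i<length haase_ziegler. us ! i *\<^sub>R haase_ziegler ! i) j
      = us ! 0 * (if j = 0 then 1 else 0) + us ! 1 * (if j = 1 then 1 else 0)
      + us ! 2 * (if j = 2 then 1 else 0) + us ! 3 * (if j < 4 then [6,14,17,101] ! j else 0)"
      unfolding len sum_lessThan_5
      by (simp add: haase_ziegler_def lookup_add lookup_point nth_Cons')
    also have "\<dots> = ?x j"
    proof (cases "j < 4")
      case True
      then show ?thesis using lt_4_cases[OF True] by (auto simp: us_def)
    qed (use assms(1) in \<open>auto simp: rspace_iff\<close>)
    finally show "Poly_Mapping.lookup (\<Sum>i<length haase_ziegler. us ! i *\<^sub>R haase_ziegler ! i) j = ?x j" .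
  qed
  finally show ?thesis .
qed

lemma haase_ziegler_interior: "body_interior 4 (convex hull (set haase_ziegler)) \<noteq> {}"
proof -
  \<comment> \<open>The barycentre. Every facet inequality has slack \<open>101/5\<close> there, and
    a step of \<open>1/10\<close> along an axis uses up at most \<open>101/10\<close>.\<close>
  let ?q = "point [7/5, 3, 18/5, 101/5]"
  have r: "?q \<in> rspace 4" by (simp add: point_in_rspace)
  have s: "Poly_Mapping.single i 1 \<in> rspace 4" if "i < 4" for i
    using that by (auto simp: rspace_iff lookup_single when_def)
  have "?q \<in> body_interior 4 (convex hull (set haase_ziegler))"
  proof (rule body_interior_cross_polytope)
    fix i :: nat assume i: "i < 4"
    show "?q + (1/10) *\<^sub>R Poly_Mapping.single i 1 \<in> convex hull (set haase_ziegler)"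
      using lt_4_cases[OF i] r s[OF i]
      by (intro haase_ziegler_hullI)
         (auto simp: lookup_add lookup_point lookup_single lookup_one when_def intro!: rspace_add rspace_scaleR)
    show "?q - (1/10) *\<^sub>R Poly_Mapping.single i 1 \<in> convex hull (set haase_ziegler)"
      using lt_4_cases[OF i] r s[OF i]
      by (intro haase_ziegler_hullI)
         (auto simp: lookup_minus lookup_point lookup_single lookup_one when_def intro!: rspace_diff rspace_scaleR)
  next
    show "?q \<in> convex hull (set haase_ziegler)"
      using r by (intro haase_ziegler_hullI) (auto simp: lookup_point)
  qed (use r in auto)
  then show ?thesis by blast
qed

text \<open>Adding up the lower bounds on \<open>101 * k0\<close>, \<open>101 * k1\<close>,
  \<open>101 * k2\<close> gives \<open>s + 3 < 102\<close>. For each remaining \<open>s\<close> the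
  least admissible \<open>k0\<close>, \<open>k1\<close>, \<open>k2\<close> are the floors plus 1,
  and they already violate the last inequality.\<close>

lemma haase_ziegler_no_interior_point:
  fixes k0 k1 k2 s :: int
  assumes "s > 0" "101 * k0 - 6 * s > 0" "101 * k1 - 14 * s > 0" "101 * k2 - 17 * s > 0"
    "101 * (k0 + k1 + k2) - 36 * s < 102"
  shows False
proof -
  define A B C where "A = 6 * s div 101" and "B = 14 * s div 101" and "C = 17 * s div 101"
  have "\<forall>s\<in>set [1..98::int]. 102 \<le> 101 * (6 * s div 101 + 14 * s div 101 + 17 * s div 101 + 3) - 36 * s"
    by code_simp
  moreover have "s \<in> set [1..98]" using assms by auto
  ultimately have "102 \<le> 101 * (A + B + C + 3) - 36 * s" unfolding A_def B_def C_def by blast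
  moreover have "A + 1 \<le> k0" "B + 1 \<le> k1" "C + 1 \<le> k2"
    using assms unfolding A_def B_def C_def by linarith+
  then have "101 * (A + B + C + 3) \<le> 101 * (k0 + k1 + k2)" by simp
  ultimately show False using assms(5) by linarith
qed

lemma haase_ziegler_hollow: "hollow 4 ((*\<^sub>R) (102/101) ` (convex hull (set haase_ziegler)))"
proof -
  have False
    if x: "x \<in> body_interior 4 ((*\<^sub>R) (102/101) ` (convex hull (set haase_ziegler)))" "x \<in> zlattice 4" for x
  proof -
    have less: "pairing 4 ((!) as) x < (102/101) * c"
      if "\<And>y. y \<in> set haase_ziegler \<Longrightarrow> pairing 4 ((!) as) y \<le> c" "i < 4" "as ! i \<noteq> 0" for as c i
      using that pairing_single[of 4 "(!) as" i]
      by (intro body_interior_hull_less[OF x(1) _ linear_pairing, where v = "Poly_Mapping.single i 1"])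
         (auto simp: rspace_iff lookup_single when_def)
    obtain k where k: "Poly_Mapping.lookup x i = of_int (k i)" for i
      using zlattice_lookup[OF x(2)] by blast
    \<comment> \<open>Four facets pass through the origin and are unaffected by the dilation; only
      the fifth bound moves, from 101 to 102.\<close>
    have "pairing 4 ((!) [0,0,0,-1]) x < (102/101) * 0"
      by (rule less[of _ _ 3]) (auto simp: haase_ziegler_def pairing_4 lookup_point)
    moreover have "pairing 4 ((!) [-101,0,0,6]) x < (102/101) * 0"
      by (rule less[of _ _ 3]) (auto simp: haase_ziegler_def pairing_4 lookup_point)
    moreover have "pairing 4 ((!) [0,-101,0,14]) x < (102/101) * 0"
      by (rule less[of _ _ 3]) (auto simp: haase_ziegler_def pairing_4 lookup_point)
    moreover have "pairing 4 ((!) [0,0,-101,17]) x < (102/101) * 0"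
      by (rule less[of _ _ 3]) (auto simp: haase_ziegler_def pairing_4 lookup_point)
    moreover have "pairing 4 ((!) [101,101,101,-36]) x < (102/101) * 101"
      by (rule less[of _ _ 3]) (auto simp: haase_ziegler_def pairing_4 lookup_point)
    ultimately have "k 3 > 0" "101 * k 0 - 6 * k 3 > 0" "101 * k 1 - 14 * k 3 > 0"
      "101 * k 2 - 17 * k 3 > 0" "101 * (k 0 + k 1 + k 2) - 36 * k 3 < 102"
      unfolding pairing_4 k by simp_all
    then show False by (rule haase_ziegler_no_interior_point)
  qed
  then show ?thesis by (auto simp: hollow_def)
qed

text \<open>Comparison with 0 confines \<open>a\<close>, \<open>b\<close>, \<open>c\<close> to
  absolute value 3; then \<open>101 * \<bar>d\<bar> \<le> 3 * 37 + 3\<close> leaves only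
  \<open>\<bar>d\<bar> \<le> 1\<close>, and the rest is a finite check.\<close>

lemma haase_ziegler_dual_check:
  fixes a b c d :: int
  assumes "\<forall>x\<in>{0, a, b, c, 6 * a + 14 * b + 17 * c + 101 * d}.
    \<forall>y\<in>{0, a, b, c, 6 * a + 14 * b + 17 * c + 101 * d}. x - y < 4"
  shows "a = 0 \<and> b = 0 \<and> c = 0 \<and> d = 0"
proof -
  let ?Q = "\<lambda>a b c d. list_all (\<lambda>x. list_all (\<lambda>y. x - y < 4) [0, a, b, c, 6 * a + 14 * b + 17 * c + 101 * d])
    [0, a, b, c, 6 * a + 14 * b + 17 * c + 101 * d]"
  have "list_all (\<lambda>a. list_all (\<lambda>b. list_all (\<lambda>c. list_all (\<lambda>d.
      ?Q a b c d \<longrightarrow> a = 0 \<and> b = 0 \<and> c = 0 \<and> d = 0) [-1..1]) [-3..3]) [-3..3]) [-3..3::int]"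
    by code_simp
  moreover have bounds: "a \<in> set [-3..3]" "b \<in> set [-3..3]" "c \<in> set [-3..3]" "d \<in> set [-1..1]"
    using assms by auto
  moreover have "?Q a b c d" using assms by (simp add: list_all_iff)
  ultimately show ?thesis unfolding list_all_iff by blast
qed

lemma haase_ziegler_wide: "wide 4 (set haase_ziegler) 4"
  unfolding wide_def
proof (intro allI impI)
  fix a :: "nat \<Rightarrow> int" assume a: "\<exists>i<4. a i \<noteq> 0"
  let ?g = "6 * a 0 + 14 * a 1 + 17 * a 2 + 101 * a 3"
  let ?S = "{0, a 0, a 1, a 2, ?g}"
  have "\<not> (a 0 = 0 \<and> a 1 = 0 \<and> a 2 = 0 \<and> a 3 = 0)" using a lt_4_cases by fastforce
  then obtain x y where xy: "x \<in> ?S" "y \<in> ?S" "4 \<le> x - y"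
    using haase_ziegler_dual_check[of "a 0" "a 1" "a 2" "a 3"] by (meson not_less)
  have "\<exists>p\<in>set haase_ziegler. pairing 4 a p = of_int z" if "z \<in> ?S" for z
    using that by (auto simp: haase_ziegler_def pairing_4 lookup_point)
  then obtain p q where "p \<in> set haase_ziegler" "q \<in> set haase_ziegler"
    "pairing 4 a p = of_int x" "pairing 4 a q = of_int y" using xy by meson
  moreover have "4 \<le> real_of_int x - real_of_int y" using xy(3) by linarith
  ultimately show "\<exists>x\<in>set haase_ziegler. \<exists>y\<in>set haase_ziegler. 4 \<le> pairing 4 a x - pairing 4 a y"
    by force
qed

lemma haase_ziegler_hollow_frame: "hollow_frame 4 (set haase_ziegler) (102/101) 4"
  using haase_ziegler_subset haase_ziegler_zero haase_ziegler_interior haase_ziegler_hollow haase_ziegler_wide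
  by (auto simp: hollow_frame_def zlattice_iff)

lemma card_4: "c \<notin> {d} \<Longrightarrow> b \<notin> {c, d} \<Longrightarrow> a \<notin> {b, c, d} \<Longrightarrow> card {a, b, c, d} = 4"
  by simp

lemma simplex_frame_insert_zero:
  assumes "independent S" "card S = d" "finite S"
  shows "simplex_frame d (insert 0 S)"
proof -
  have "0 \<notin> S" using assms(1) dependent_zero by blast
  then show ?thesis using assms by (simp add: simplex_frame_def)
qed

lemma haase_ziegler_simplex_frame: "simplex_frame 4 (set haase_ziegler)"
proof -
  let ?e0 = "point [1,0,0,0]" and ?e1 = "point [0,1,0,0]" and ?e2 = "point [0,0,1,0]"
    and ?v = "point [6,14,17,101]"
  have z: "point [0,0,0,0] = 0"
    by (rule poly_mapping_eqI) (auto simp: lookup_point nth_Cons')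
  \<comment> \<open>The vectors are adjoined from last to first; each functional vanishes on those
    already present and not on the new one.\<close>
  have 0: "?v \<notin> span {}"
    by (rule not_in_span_if_functional[of "pairing 4 ((!) [0,0,0,1])", OF linear_pairing])
       (auto simp: pairing_4 lookup_point)
  have 1: "?e2 \<notin> span {?v}"
    by (rule not_in_span_if_functional[of "pairing 4 ((!) [0,0,101,-17])", OF linear_pairing])
       (auto simp: pairing_4 lookup_point)
  have 2: "?e1 \<notin> span {?e2, ?v}"
    by (rule not_in_span_if_functional[of "pairing 4 ((!) [0,101,0,-14])", OF linear_pairing])
       (auto simp: pairing_4 lookup_point)
  have 3: "?e0 \<notin> span {?e1, ?e2, ?v}"
    by (rule not_in_span_if_functional[of "pairing 4 ((!) [101,0,0,-6])", OF linear_pairing])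
       (auto simp: pairing_4 lookup_point)
  have ind: "independent {?e0, ?e1, ?e2, ?v}"
    using 0 1 2 3 by (intro independent_insertI independent_empty)
  have "card {?e0, ?e1, ?e2, ?v} = 4"
  proof (rule card_4)
    show "?e2 \<notin> {?v}" using 1 by (meson span_base)
    show "?e1 \<notin> {?e2, ?v}" using 2 by (meson span_base)
    show "?e0 \<notin> {?e1, ?e2, ?v}" using 3 by (meson span_base)
  qed
  with ind have "simplex_frame 4 (insert 0 {?e0, ?e1, ?e2, ?v})"
    by (rule simplex_frame_insert_zero) simp
  moreover have "set haase_ziegler = insert 0 {?e0, ?e1, ?e2, ?v}"
    unfolding haase_ziegler_def list.set z by blast
  ultimately show ?thesis by (rule ssubst[rotated])
qed

text \<open>With \<open>101 * j\<close> summands the admissible dilation is exactly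
  \<open>102 * j\<close>: width \<open>408 * j\<close> in dimension \<open>404 * j\<close>.\<close>

lemma liminf_w_s_ge: "ereal (102/101) \<le> liminf (\<lambda>d. w_s d / ereal (real d))"
proof -
  have "ereal (real j * 408) \<le> w_s d" if "j \<ge> 1" "d \<ge> j * 404" for j d
  proof -
    have "real (102 * j) *\<^sub>R x \<in> zlattice 4" if "x \<in> set haase_ziegler" for x
      using that haase_ziegler_subset by (auto simp: zlattice_iff rspace_scaleR)
    then have "ereal (real (102 * j) * 4) \<le> w_s d"
      using that haase_ziegler_simplex_frame
      by (intro hollow_frame_lower_bound(2)[OF haase_ziegler_hollow_frame, of "102 * j" "101 * j"]) auto
    then show ?thesis by (simp add: algebra_simps)
  qed
  then have "ereal (408 / real 404) \<le> liminf (\<lambda>d. w_s d / ereal (real d))"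
    by (intro liminf_quotient_ge) auto
  then show ?thesis by simp
qed

section \<open>A hollow tetrahedron of width \<open>2 + \<surd>2\<close>\<close>

text \<open>In the coordinates \<open>(x\<^sub>0, \<dots>, x\<^sub>3)\<close> of the affine lattice \<open>{x \<in> \<int>\<^sup>4. \<Sum> x\<^sub>i = 1}\<close>, of which
  \<open>x\<^sub>0\<close> is dropped, the vertices of the tetrahedron are the cyclic shifts of
  \<open>(\<tau>/4 - \<tau>, \<tau>/4 + 1, \<tau>/4, \<tau>/4)\<close> with \<open>\<tau> = 1 + \<surd>2\<close>, and its facets, indices modulo 4, are
  \<open>(3 - \<surd>2) x\<^sub>j\<^sub>+\<^sub>1 + \<surd>2 x\<^sub>j\<^sub>+\<^sub>2 + x\<^sub>j\<^sub>+\<^sub>3 = 0\<close>; the unit vector \<open>e\<^sub>j\<close> lies on the \<open>j\<close>-th one.\<close>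

definition tetra_vertex :: "real \<Rightarrow> real \<Rightarrow> real \<Rightarrow> (nat \<Rightarrow>\<^sub>0 real)" where
  "tetra_vertex a b c = point [(1 + sqrt 2) / 4 + a, (1 + sqrt 2) / 4 + b, (1 + sqrt 2) / 4 + c]"

definition tetra :: "(nat \<Rightarrow>\<^sub>0 real) list" where
  "tetra = [tetra_vertex 1 0 0, tetra_vertex (- (1 + sqrt 2)) 1 0,
    tetra_vertex 0 (- (1 + sqrt 2)) 1, tetra_vertex 0 0 (- (1 + sqrt 2))]"

lemma tetra_in_rspace: "set tetra \<subseteq> rspace 3"
  by (auto simp: tetra_def tetra_vertex_def point_in_rspace)

lemma lookup_tetra_vertex:
  "Poly_Mapping.lookup (tetra_vertex a b c) 0 = (1 + sqrt 2) / 4 + a"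
  "Poly_Mapping.lookup (tetra_vertex a b c) 1 = (1 + sqrt 2) / 4 + b"
  "Poly_Mapping.lookup (tetra_vertex a b c) (Suc 0) = (1 + sqrt 2) / 4 + b"
  "Poly_Mapping.lookup (tetra_vertex a b c) 2 = (1 + sqrt 2) / 4 + c"
  by (simp_all add: tetra_vertex_def lookup_point)

definition tetra_facet :: "nat \<Rightarrow> (nat \<Rightarrow>\<^sub>0 real) \<Rightarrow> real" where
  "tetra_facet j x = (let y = (\<lambda>i. Poly_Mapping.lookup x i); x0 = 1 - y 0 - y 1 - y 2 in
     [(3 - sqrt 2) * y 0 + sqrt 2 * y 1 + y 2, (3 - sqrt 2) * y 1 + sqrt 2 * y 2 + x0,
      (3 - sqrt 2) * y 2 + sqrt 2 * x0 + y 0, (3 - sqrt 2) * x0 + sqrt 2 * y 0 + y 1] ! j)"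

lemma tetra_facet_simps:
  fixes x :: "nat \<Rightarrow>\<^sub>0 real"
  defines "y \<equiv> Poly_Mapping.lookup x"
  shows "tetra_facet 0 x = (3 - sqrt 2) * y 0 + sqrt 2 * y 1 + y 2"
    "tetra_facet 1 x = 1 - y 0 + (2 - sqrt 2) * y 1 + (sqrt 2 - 1) * y 2"
    "tetra_facet 2 x = sqrt 2 + (1 - sqrt 2) * y 0 - sqrt 2 * y 1 + (3 - 2 * sqrt 2) * y 2"
    "tetra_facet 3 x = 3 - sqrt 2 + (2 * sqrt 2 - 3) * y 0 + (sqrt 2 - 2) * y 1 - (3 - sqrt 2) * y 2"
  by (simp_all add: tetra_facet_def Let_def y_def algebra_simps)

lemma sqrt2_bounds: "1.41 < sqrt 2" "sqrt 2 < 1.42" "sqrt 2 * sqrt 2 = 2"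
proof -
  show "1.41 < sqrt 2" by (rule real_less_rsqrt) (simp add: power2_eq_square)
  show "sqrt 2 < 1.42" by (rule real_less_lsqrt) (simp_all add: power2_eq_square)
qed simp

text \<open>Each facet function has the value 4 at the vertex opposite to its facet, so its quarter
  is a barycentric coordinate.\<close>

lemma tetra_hullI:
  assumes "x \<in> rspace 3" "\<And>j. j < 4 \<Longrightarrow> tetra_facet j x \<ge> 0"
  shows "x \<in> convex hull (set tetra)"
proof -
  have len: "length tetra = 4" by (simp add: tetra_def)
  have "(\<Sum>j<length tetra. (tetra_facet j x / 4) *\<^sub>R tetra ! j) \<in> convex hull (set tetra)"
  proof (rule convex_combination_list)
    show "(\<Sum>j<length tetra. tetra_facet j x / 4) = 1"
      unfolding len sum_lessThan_4 tetra_facet_simps by (simp add: algebra_simps flip: add_divide_distrib)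
  qed (use assms(2) len in auto)
  also have "(\<Sum>j<length tetra. (tetra_facet j x / 4) *\<^sub>R tetra ! j) = x"
  proof (rule poly_mapping_eqI)
    fix i
    have eq: "Poly_Mapping.lookup (\<Sum>j<length tetra. (tetra_facet j x / 4) *\<^sub>R tetra ! j) i
      = tetra_facet 0 x / 4 * Poly_Mapping.lookup (tetra ! 0) i
      + tetra_facet 1 x / 4 * Poly_Mapping.lookup (tetra ! 1) i
      + tetra_facet 2 x / 4 * Poly_Mapping.lookup (tetra ! 2) i
      + tetra_facet 3 x / 4 * Poly_Mapping.lookup (tetra ! 3) i"
      unfolding len sum_lessThan_4 by (simp add: lookup_add)
    show "Poly_Mapping.lookup (\<Sum>j<length tetra. (tetra_facet j x / 4) *\<^sub>R tetra ! j) i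
      = Poly_Mapping.lookup x i"
    proof (cases "i < 3")
      case True
      have s: "sqrt 2 * (sqrt 2 * c) = 2 * c" for c by simp
      have "tetra_facet 0 x * Poly_Mapping.lookup (tetra ! 0) i
          + tetra_facet 1 x * Poly_Mapping.lookup (tetra ! 1) i
          + tetra_facet 2 x * Poly_Mapping.lookup (tetra ! 2) i
          + tetra_facet 3 x * Poly_Mapping.lookup (tetra ! 3) i = 4 * Poly_Mapping.lookup x i"
        using lt_3_cases[OF True] unfolding tetra_facet_simps
        by (elim disjE) (simp_all add: tetra_def lookup_tetra_vertex field_simps s)
      then show ?thesis unfolding eq by (simp add: field_simps)
    next
      case False
      then have "Poly_Mapping.lookup (tetra ! j) i = 0" if "j < 4" for j
        using tetra_in_rspace that len by (metis not_less nth_mem rspace_iff subsetD)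
      then show ?thesis using False assms(1) unfolding eq by (simp add: rspace_iff)
    qed
  qed
  finally show ?thesis .
qed

lemma tetra_interior: "body_interior 3 (convex hull (set tetra)) \<noteq> {}"
proof -
  \<comment> \<open>All four coordinates of the affine lattice equal \<open>1/4\<close> here, and
    all four facet functions equal 1.\<close>
  let ?q = "point [1/4, 1/4, 1/4]"
  have r: "?q \<in> rspace 3" by (simp add: point_in_rspace)
  have s: "Poly_Mapping.single i 1 \<in> rspace 3" if "i < 3" for i
    using that by (auto simp: rspace_iff lookup_single when_def)
  have "?q \<in> body_interior 3 (convex hull (set tetra))"
  proof (rule body_interior_cross_polytope)
    fix i :: nat assume i: "i < 3"
    show "?q + (1/10) *\<^sub>R Poly_Mapping.single i 1 \<in> convex hull (set tetra)"
      using lt_3_cases[OF i] r s[OF i] sqrt2_bounds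
      by (intro tetra_hullI)
         (auto simp: tetra_facet_def Let_def lookup_add lookup_point lookup_single lookup_one when_def algebra_simps
           intro!: rspace_add rspace_scaleR dest!: lt_4_cases)
    show "?q - (1/10) *\<^sub>R Poly_Mapping.single i 1 \<in> convex hull (set tetra)"
      using lt_3_cases[OF i] r s[OF i] sqrt2_bounds
      by (intro tetra_hullI)
         (auto simp: tetra_facet_def Let_def lookup_minus lookup_point lookup_single lookup_one when_def algebra_simps
           intro!: rspace_diff rspace_scaleR dest!: lt_4_cases)
  next
    show "?q \<in> convex hull (set tetra)"
      using r sqrt2_bounds
      by (intro tetra_hullI) (auto simp: tetra_facet_def Let_def lookup_point algebra_simps dest!: lt_4_cases)
  qed (use r in auto)
  then show ?thesis by blast
qed

text \<open>The four coordinates, now including the dropped one as \<open>p\<close>, lie in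
  \<open>{-1, 0, 1}\<close> and sum to 1; rational bounds on \<open>sqrt 2\<close> settle each
  case.\<close>

lemma tetra_no_interior_point:
  fixes p q r x :: int
  assumes "x = 1 - p - q - r" "\<forall>k\<in>{p, q, r, x}. -2 < k \<and> k < 2"
    "(3 - sqrt 2) * p + sqrt 2 * q + r > 0" "(3 - sqrt 2) * q + sqrt 2 * r + x > 0"
    "(3 - sqrt 2) * r + sqrt 2 * x + p > 0" "(3 - sqrt 2) * x + sqrt 2 * p + q > 0"
  shows False
proof -
  have range: "k = -1 \<or> k = 0 \<or> k = 1" if "k \<in> {p, q, r, x}" for k
    using assms(2) that by fastforce
  have "p = -1 \<or> p = 0 \<or> p = 1" "q = -1 \<or> q = 0 \<or> q = 1" "r = -1 \<or> r = 0 \<or> r = 1"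
    "x = -1 \<or> x = 0 \<or> x = 1" using range by auto
  then show False
    using assms(1,3-) sqrt2_bounds(1,2) by (elim disjE) simp_all
qed

lemma tetra_hollow: "hollow 3 (convex hull (set tetra))"
proof -
  have False if x: "x \<in> body_interior 3 (convex hull (set tetra))" "x \<in> zlattice 3" for x
  proof -
    let ?y = "\<lambda>z i. Poly_Mapping.lookup (z :: nat \<Rightarrow>\<^sub>0 real) i"
    have less: "a * ?y x 0 + b * ?y x 1 + c * ?y x 2 < u"
      if le: "\<And>y. y \<in> set tetra \<Longrightarrow> a * ?y y 0 + b * ?y y 1 + c * ?y y 2 \<le> u"
        and nz: "i < 3" "[a, b, c] ! i \<noteq> 0" for a b c u i
    proof -
      let ?f = "\<lambda>z. a * ?y z 0 + b * ?y z 1 + c * ?y z 2"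
      have lin: "linear ?f" by (rule linearI) (simp_all add: lookup_add algebra_simps)
      let ?v = "Poly_Mapping.single i 1"
      have "?f ?v = [a, b, c] ! i"
        using lt_3_cases[OF nz(1)] by (auto simp: lookup_single lookup_one when_def)
      moreover have "?v \<in> rspace 3" using nz(1) by (auto simp: rspace_iff lookup_single when_def)
      ultimately have "?f x < 1 * u"
        using x(1) le nz(2) by (intro body_interior_hull_less[OF _ _ lin, of x 3 1 "set tetra" _ ?v]) auto
      then show ?thesis by simp
    qed
    obtain k where k: "?y x i = of_int (k i)" for i
      using zlattice_lookup[OF x(2)] by blast
    note vertex_simps = tetra_def lookup_tetra_vertex field_simps
    have "(sqrt 2 - 3) * ?y x 0 + (- sqrt 2) * ?y x 1 + (-1) * ?y x 2 < 0"
      by (rule less[of _ _ _ _ 2]) (use sqrt2_bounds in \<open>auto simp: vertex_simps\<close>)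
    moreover have "1 * ?y x 0 + (sqrt 2 - 2) * ?y x 1 + (1 - sqrt 2) * ?y x 2 < 1"
      by (rule less[of _ _ _ _ 0]) (use sqrt2_bounds in \<open>auto simp: vertex_simps\<close>)
    moreover have "(sqrt 2 - 1) * ?y x 0 + sqrt 2 * ?y x 1 + (2 * sqrt 2 - 3) * ?y x 2 < sqrt 2"
      by (rule less[of _ _ _ _ 1]) (use sqrt2_bounds in \<open>auto simp: vertex_simps\<close>)
    moreover have "(3 - 2 * sqrt 2) * ?y x 0 + (2 - sqrt 2) * ?y x 1 + (3 - sqrt 2) * ?y x 2 < 3 - sqrt 2"
      by (rule less[of _ _ _ _ 1]) (use sqrt2_bounds in \<open>auto simp: vertex_simps\<close>)
    moreover have "\<bar>?y x 0\<bar> < 2" "\<bar>?y x 1\<bar> < 2" "\<bar>?y x 2\<bar> < 2"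
    proof -
      have "1 * ?y x 0 + 0 * ?y x 1 + 0 * ?y x 2 < 2" "(-1) * ?y x 0 + 0 * ?y x 1 + 0 * ?y x 2 < 2"
        by (rule less[of _ _ _ _ 0]; use sqrt2_bounds in \<open>auto simp: vertex_simps\<close>)+
      then show "\<bar>?y x 0\<bar> < 2" by simp
      have "0 * ?y x 0 + 1 * ?y x 1 + 0 * ?y x 2 < 2" "0 * ?y x 0 + (-1) * ?y x 1 + 0 * ?y x 2 < 2"
        by (rule less[of _ _ _ _ 1]; use sqrt2_bounds in \<open>auto simp: vertex_simps\<close>)+
      then show "\<bar>?y x 1\<bar> < 2" by simp
      have "0 * ?y x 0 + 0 * ?y x 1 + 1 * ?y x 2 < 2" "0 * ?y x 0 + 0 * ?y x 1 + (-1) * ?y x 2 < 2"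
        by (rule less[of _ _ _ _ 2]; use sqrt2_bounds in \<open>auto simp: vertex_simps\<close>)+
      then show "\<bar>?y x 2\<bar> < 2" by simp
    qed
    \<comment> \<open>Bounds between -2 and 2 for the dropped coordinate, which is 1 minus the
      sum.\<close>
    moreover have "1 * ?y x 0 + 1 * ?y x 1 + 1 * ?y x 2 < 3" "(-1) * ?y x 0 + (-1) * ?y x 1 + (-1) * ?y x 2 < 1"
      by (rule less[of _ _ _ _ 0]; use sqrt2_bounds in \<open>auto simp: vertex_simps\<close>)+
    ultimately show False
      unfolding k
      by (intro tetra_no_interior_point[of "1 - k 0 - k 1 - k 2" "k 0" "k 1" "k 2"]) (auto simp: algebra_simps)
  qed
  then show ?thesis by (auto simp: hollow_def)
qed

text \<open>Going round the cycle from a maximal entry, the values must drop somewhere; the entry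
  before the first drop is still maximal.\<close>

lemma cyclic_max:
  fixes p q r s :: int
  assumes "\<not> (p = q \<and> q = r \<and> r = s)"
  obtains x x' where "(x, x') \<in> {(p, q), (q, r), (r, s), (s, p)}" "x' < x" "p \<le> x" "q \<le> x" "r \<le> x" "s \<le> x"
  using assms by simp (smt (verit))

text \<open>A functional \<open>g\<close> takes the value \<open>g\<^sub>j\<^sub>+\<^sub>1 - \<tau> g\<^sub>j\<close>, up to a constant, at the \<open>j\<close>-th vertex.
  Choosing a maximal \<open>g\<^sub>j\<close> followed by a smaller value and a minimal \<open>g\<^sub>k\<close> followed by a larger
  one gives a difference of at least \<open>2 + (\<tau> - 1) (g\<^sub>j - g\<^sub>k)\<close>.\<close>

lemma tetra_wide: "wide 3 (set tetra) (2 + sqrt 2)"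
  unfolding wide_def
proof (intro allI impI)
  fix a :: "nat \<Rightarrow> int" assume a: "\<exists>i<3. a i \<noteq> 0"
  \<comment> \<open>The pairs of cyclically consecutive coefficients; the dropped coordinate has
    coefficient 0.\<close>
  let ?T = "{(0, a 0), (a 0, a 1), (a 1, a 2), (a 2, 0)}"
  let ?c = "(1 + sqrt 2) / 4 * of_int (a 0 + a 1 + a 2)"
  have val: "\<exists>v\<in>set tetra. pairing 3 a v = ?c + of_int x' - (1 + sqrt 2) * of_int x" if "(x, x') \<in> ?T" for x x'
  proof -
    have p: "pairing 3 a (tetra_vertex u v w) = ?c + of_int (a 0) * u + of_int (a 1) * v + of_int (a 2) * w" for u v w
      by (simp add: pairing_3 lookup_tetra_vertex algebra_simps add_divide_distrib)
    from that consider "x = 0" "x' = a 0" | "x = a 0" "x' = a 1" | "x = a 1" "x' = a 2" | "x = a 2" "x' = 0"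
      by auto
    then show ?thesis
    proof cases
      case 1 then show ?thesis by (intro bexI[of _ "tetra ! 0"]) (auto simp: tetra_def p)
    next
      case 2 then show ?thesis by (intro bexI[of _ "tetra ! 1"]) (auto simp: tetra_def p algebra_simps)
    next
      case 3 then show ?thesis by (intro bexI[of _ "tetra ! 2"]) (auto simp: tetra_def p algebra_simps)
    next
      case 4 then show ?thesis by (intro bexI[of _ "tetra ! 3"]) (auto simp: tetra_def p algebra_simps)
    qed
  qed
  have nz: "\<not> (0 = a 0 \<and> a 0 = a 1 \<and> a 1 = a 2)" using a lt_3_cases by fastforce
  obtain x x' where x: "(x, x') \<in> ?T" "x' < x" "0 \<le> x" "a 0 \<le> x" "a 1 \<le> x" "a 2 \<le> x"
    using cyclic_max[OF nz] by blast
  \<comment> \<open>Negation turns the search for a minimum followed by a larger value into the same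
    lemma, so \<open>- z\<close> is the minimum and \<open>x + z\<close> the spread.\<close>
  have nz': "\<not> (- 0 = - a 0 \<and> - a 0 = - a 1 \<and> - a 1 = - a 2)" using nz by linarith
  obtain z z' where "(z, z') \<in> {(- 0, - a 0), (- a 0, - a 1), (- a 1, - a 2), (- a 2, - 0)}" "z' < z"
    "- 0 \<le> z" "- a 0 \<le> z" "- a 1 \<le> z" "- a 2 \<le> z"
    using cyclic_max[OF nz'] by blast
  then have z: "(- z, - z') \<in> ?T" "z' < z" "- z \<le> 0" "- z \<le> a 0" "- z \<le> a 1" "- z \<le> a 2" by auto
  have "- z < x" using nz x z by linarith
  then have "real_of_int (x + z) \<ge> 1" by linarith
  then have "sqrt 2 * real_of_int (x + z) \<ge> sqrt 2 * 1" by (intro mult_left_mono) auto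
  moreover have "real_of_int x' \<le> real_of_int x - 1" "real_of_int z' \<le> real_of_int z - 1"
    using x z by linarith+
  ultimately have "2 + sqrt 2 \<le> (?c + of_int (- z') - (1 + sqrt 2) * of_int (- z))
      - (?c + of_int x' - (1 + sqrt 2) * of_int x)"
    by (simp add: algebra_simps)
  then show "\<exists>x\<in>set tetra. \<exists>y\<in>set tetra. 2 + sqrt 2 \<le> pairing 3 a x - pairing 3 a y"
    using val[OF x(1)] val[OF z(1)] by metis
qed

lemma w_c_3_ge: "ereal (2 + sqrt 2) \<le> w_c 3"
proof -
  let ?K = "convex hull (set tetra)"
  have "convex_body 3 ?K"
    using tetra_interior tetra_in_rspace
    by (auto simp: convex_body_def finite_imp_compact_convex_hull dest: convex_hull_subset_rspace)
  moreover have "2 + sqrt 2 \<le> lattice_width 3 ?K"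
    using tetra_wide tetra_in_rspace
    by (intro lattice_width_ge[of 3 "set tetra"] bounded_convex_hull_finite convex_hull_subset_rspace) (auto intro: hull_inc)
  ultimately show ?thesis
    unfolding w_c_def using tetra_hollow by (intro SUP_upper2[of ?K]) auto
qed

theorem theorem1p6:
  shows "convergent (\<lambda>d. w_p d / ereal (real d))
    \<and> convergent (\<lambda>d. w_c d / ereal (real d))
    \<and> convergent (\<lambda>d. w_s d / ereal (real d))
    \<and> lim (\<lambda>d. w_p d / ereal (real d)) = lim (\<lambda>d. w_c d / ereal (real d))
    \<and> lim (\<lambda>d. w_c d / ereal (real d)) \<ge> ereal ((2 + sqrt 2) / 3)
    \<and> lim (\<lambda>d. w_s d / ereal (real d)) \<ge> ereal (102 / 101)"
proof -
  let ?L = "liminf (\<lambda>d. w_p d / ereal (real d))" and ?M = "liminf (\<lambda>d. w_s d / ereal (real d))"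
  have le: "w_p n / ereal (real n) \<le> w_c n / ereal (real n)" if "n \<ge> 1" for n
    using that by (intro ereal_divide_right_mono w_p_le_w_c) auto
  have pc: "(\<lambda>d. w_p d / ereal (real d)) \<longlonglongrightarrow> ?L" "(\<lambda>d. w_c d / ereal (real d)) \<longlonglongrightarrow> ?L"
    using convergent_of_le_liminf[OF w_c_le_liminf_w_p le] by auto
  have "0 \<le> ?M" using liminf_w_s_ge by (rule order_trans[rotated]) simp
  \<comment> \<open>Here both sequences of the squeeze are the same.\<close>
  then have s: "(\<lambda>d. w_s d / ereal (real d)) \<longlonglongrightarrow> ?M"
    by (intro convergent_of_le_liminf(1)[of "\<lambda>d. w_s d / ereal (real d)"] w_s_le_liminf_w_s) auto
  have "ereal ((2 + sqrt 2) / 3) = ereal (2 + sqrt 2) / ereal (real 3)" by simp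
  also have "\<dots> \<le> w_c 3 / ereal (real 3)"
    by (intro ereal_divide_right_mono w_c_3_ge) auto
  also have "\<dots> \<le> ?L" by (rule w_c_le_liminf_w_p) simp
  finally show ?thesis
    using pc s liminf_w_s_ge limI[OF pc(1)] limI[OF pc(2)] limI[OF s]
    by (auto simp: convergent_def)
qed

end
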